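(* There are at most $124$ pairwise non-isomorphic groups of complexity $(3,2)$. That is, the set of isomorphism classes of groups $G(A)$, where $A$ runs over all invertible automata with $3$ states over a $2$-letter alphabet, has at most $124$ elements.
   Context: Let $X=\{0,1\}$ and let $X^*$ be the set of finite words over $X$, viewed as the rooted binary tree (root is the empty word, the children of $v$ are $v0,v1$). An invertible automaton $A$ with $3$ states $1,2,3$ over $X$ is given by a system $q=\sigma^{a_{q1}}(a_{q2},a_{q3})$, $q=1,2,3$, where $a_{q1}\in\{0,1\}$, $a_{q2},a_{q3}\in\{1,2,3\}$ and $\sigma$ is the transposition $(01)$ of $X$. Each state $q$ defines an automorphism of the tree $X^*$ (also denoted $q$), recursively by $q(\emptyset)=\emptyset$, $q(0w)=\sigma^{a_{q1}}(0)\,a_{q2}(w)$ and $q(1w)=\sigma^{a_{q1}}(1)\,a_{q3}(w)$ for all $w\in X^*$. The automaton group $G(A)$ is the subgroup of $\mathrm{Aut}(X^* )$ generated by the three states. There are $2^3\cdot 3^6=5832$ such automata. A group has complexity $(3,2)$ if it is isomorphic to $G(A)$ for such an $A$. *)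

theory Defs
  imports "HOL-Algebra.Algebra"
begin

(* The letters 0 and 1 are False and True; the vertices of the binary tree are the words over bool,
   with the empty word as root. *)

definition child :: "bool list \<Rightarrow> bool list \<Rightarrow> bool" where
  "child u v \<longleftrightarrow> (\<exists>x. v = u @ [x])"

definition tree_aut :: "(bool list \<Rightarrow> bool list) monoid" where
  "tree_aut =
     \<lparr>carrier = {f. bij f \<and> f [] = [] \<and> (\<forall>u v. child (f u) (f v) \<longleftrightarrow> child u v)},
      monoid.mult = (\<circ>), one = id\<rparr>"

datatype state = S1 | S2 | S3

(* A q = (s, l, r) encodes the line q = sigma^s (l, r) of the defining system,
   sigma being the transposition of the two letters. *)
type_synonym automaton = "state \<Rightarrow> bool \<times> state \<times> state"

fun state_map :: "automaton \<Rightarrow> state \<Rightarrow> bool list \<Rightarrow> bool list" where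
  "state_map A q [] = []"
| "state_map A q (x # w) =
     (case A q of (s, l, r) \<Rightarrow>
        (if s then \<not> x else x) # state_map A (if x then r else l) w)"

definition automaton_group :: "automaton \<Rightarrow> (bool list \<Rightarrow> bool list) monoid" where
  "automaton_group A = subgroup_generated tree_aut (range (state_map A))"

definition complexity_3_2 :: "('a, 'b) monoid_scheme \<Rightarrow> bool" where
  "complexity_3_2 G \<longleftrightarrow> group G \<and> (\<exists>A. G \<cong> automaton_group A)"

definition iso_classes :: "('a, 'b) monoid_scheme set \<Rightarrow> ('a, 'b) monoid_scheme set set" where
  "iso_classes \<G> = \<G> // {(G, H). G \<in> \<G> \<and> H \<in> \<G> \<and> G \<cong> H}"

lemma group_tree_aut: "group tree_aut"
proof (rule groupI)
  fix f assume f: "f \<in> carrier tree_aut"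
  then have b: "bij f" and r: "f [] = []" and c: "\<And>u v. child (f u) (f v) \<longleftrightarrow> child u v"
    by (auto simp: tree_aut_def)
  have s: "f (inv_into UNIV f x) = x" for x
    using b by (simp add: bij_is_surj surj_f_inv_f)
  have "inv_into UNIV f [] = []"
    using b r by (metis bij_inv_eq_iff)
  moreover have "child (inv_into UNIV f u) (inv_into UNIV f v) \<longleftrightarrow> child u v" for u v
    using c[of "inv_into UNIV f u" "inv_into UNIV f v"] by (simp add: s)
  moreover have "inv_into UNIV f \<circ> f = id"
    using b by (simp add: bij_is_inj)
  ultimately show "\<exists>g\<in>carrier tree_aut. g \<otimes>\<^bsub>tree_aut\<^esub> f = \<one>\<^bsub>tree_aut\<^esub>"
    using b by (intro bexI[of _ "inv_into UNIV f"]) (auto simp: tree_aut_def bij_imp_bij_inv)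
qed (auto simp: tree_aut_def bij_comp)

lemma length_state_map [simp]: "length (state_map A q w) = length w"
  by (induction w arbitrary: q) (auto split: prod.splits)

lemma inj_state_map: "state_map A q u = state_map A q v \<Longrightarrow> u = v"
proof (induction u arbitrary: q v)
  case Nil
  then show ?case by (metis length_0_conv length_state_map)
next
  case (Cons x u)
  then obtain y v' where v: "v = y # v'"
    by (metis length_0_conv length_state_map list.exhaust list.distinct(1))
  with Cons show ?case
    by (auto split: prod.splits if_splits)
qed

lemma surj_state_map: "\<exists>u. state_map A q u = v"
proof (induction v arbitrary: q)
  case Nil
  show ?case by (rule exI[of _ "[]"]) simp
next
  case (Cons y v)
  obtain s l r where A: "A q = (s, l, r)" by (cases "A q")
  define x where "x = (if s then \<not> y else y)"
  obtain u where "state_map A (if x then r else l) u = v" using Cons by blast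
  then show ?case
    by (intro exI[of _ "x # u"]) (auto simp: A x_def)
qed

lemma state_map_snoc: "\<exists>y. state_map A q (u @ [x]) = state_map A q u @ [y]"
  by (induction u arbitrary: q) (auto split: prod.splits)

lemma child_state_map: "child (state_map A q u) (state_map A q v) \<longleftrightarrow> child u v"
proof
  assume "child u v"
  then show "child (state_map A q u) (state_map A q v)"
    using state_map_snoc by (auto simp: child_def)
next
  assume "child (state_map A q u) (state_map A q v)"
  then obtain y where y: "state_map A q v = state_map A q u @ [y]" by (auto simp: child_def)
  then have "length v = Suc (length u)" by (metis length_append_singleton length_state_map)
  then obtain v' x where v: "v = v' @ [x]" by (metis length_Suc_conv_rev)
  with y state_map_snoc[of A q v' x] have "state_map A q v' = state_map A q u" by auto
  then show "child u v" using inj_state_map v by (auto simp: child_def)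
qed

lemma state_map_in_tree_aut: "state_map A q \<in> carrier tree_aut"
  using inj_state_map surj_state_map child_state_map
  by (auto simp: tree_aut_def bij_def inj_def surj_def) metis

lemma group_automaton_group: "group (automaton_group A)"
  unfolding automaton_group_def by (rule group.group_subgroup_generated[OF group_tree_aut])

end

theory Submission
  imports Defs
begin

text \<open>
  Renaming states, inverting all states and exchanging the two letters do not change the group up
  to isomorphism. The remaining isomorphisms between automaton groups that are needed here are
  all induced by conjugation in the automorphism group of the tree: after Nielsen
  moves on the generators of \<open>G(B)\<close>, the states of \<open>A\<close> and the new generators of \<open>G(B)\<close> are
  simultaneously conjugate. The conjugating automorphism is defined by a wreath recursion over
  \<open>G(B)\<close>, so that the conjugacy is equivalent to finitely many word problems in \<open>G(B)\<close>, each of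
  which is settled by a finite set of words that is closed under taking sections. This leaves 123
  representatives.
\<close>

section \<open>Group words acting on the tree\<close>

text \<open>Isomorphism cannot be read off from two automata, so every identification is given by an
  explicit witness whose verification must be finite. What makes it finite is that a section of a
  word of length n over the states and their inverses is again such a word of length n: only
  finitely many words arise from a given one, and it acts trivially iff all of them fix both
  letters. A conjugator is an infinite object that need not lie in either group. If its wreath
  recursion visits finitely many automorphisms and has its coefficients in G(B), comparing sections
  still leaves only finitely many equations between words over B. Only an upper bound is claimed, so
  nothing has to be shown about the representatives being pairwise non-isomorphic.\<close>

datatype letter = Pos state | Neg state

type_synonym group_word = "letter list"

fun inv_letter :: "letter \<Rightarrow> letter" where
  "inv_letter (Pos q) = Neg q"
| "inv_letter (Neg q) = Pos q"

definition inv_word :: "group_word \<Rightarrow> group_word" where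
  "inv_word w = rev (map inv_letter w)"

text \<open>The inverse of \<open>q\<close> moves a letter as \<open>q\<close> does, but its section
  at \<open>x\<close> is inverse to the section of \<open>q\<close> at the preimage
  \<open>x \<noteq> s\<close>. This accounts for the different tests in the two equations.\<close>

fun letter_step :: "automaton \<Rightarrow> bool \<Rightarrow> letter \<Rightarrow> bool \<times> letter" where
  "letter_step A x (Pos q) = (case A q of (s, l, r) \<Rightarrow> (x \<noteq> s, Pos (if x then r else l)))"
| "letter_step A x (Neg q) = (case A q of (s, l, r) \<Rightarrow> (x \<noteq> s, Neg (if x \<noteq> s then r else l)))"

text \<open>A word is treated as one state of a product automaton. The section has the length of the
  input word, which keeps the set of iterated sections finite even before any cancellation.\<close>

fun word_step :: "automaton \<Rightarrow> bool \<Rightarrow> group_word \<Rightarrow> bool \<times> group_word" where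
  "word_step A x [] = (x, [])"
| "word_step A x (a # w) =
     (case letter_step A x a of (y, b) \<Rightarrow> (case word_step A y w of (z, v) \<Rightarrow> (z, b # v)))"

\<comment> \<open>Words act from the right: the head of \<open>w\<close> is applied first.\<close>
fun word_map :: "automaton \<Rightarrow> group_word \<Rightarrow> bool list \<Rightarrow> bool list" where
  "word_map A w [] = []"
| "word_map A w (x # u) = (case word_step A x w of (y, v) \<Rightarrow> y # word_map A v u)"

lemma length_word_map [simp]: "length (word_map A w u) = length u"
  by (induction u arbitrary: w) (auto split: prod.splits)

lemma word_step_append:
  "word_step A x (v @ w) =
     (case word_step A x v of (y, v') \<Rightarrow> (case word_step A y w of (z, w') \<Rightarrow> (z, v' @ w')))"
  by (induction v arbitrary: x) (auto split: prod.splits)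

lemma word_map_Nil [simp]: "word_map A [] = id"
proof
  show "word_map A [] u = id u" for u by (induction u) auto
qed

lemma word_map_append: "word_map A (v @ w) u = word_map A w (word_map A v u)"
  by (induction u arbitrary: v w) (auto simp: word_step_append split: prod.splits)

lemma word_map_Cons: "word_map A (a # w) u = word_map A w (word_map A [a] u)"
  using word_map_append[of A "[a]" w] by simp

lemma word_map_Pos: "word_map A [Pos q] = state_map A q"
proof
  show "word_map A [Pos q] u = state_map A q u" for u
    by (induction u arbitrary: q) (auto split: prod.splits)
qed

text \<open>An arrow of the automaton read backwards is an arrow of the inverse automaton.\<close>

lemma letter_step_inv:
  "letter_step A x a = (y, b) \<Longrightarrow> letter_step A y (inv_letter a) = (x, inv_letter b)"
  by (cases a) (auto split: prod.splits)

lemma word_map_inv_letter: "word_map A [inv_letter a] (word_map A [a] u) = u"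
  by (induction u arbitrary: a) (auto split: prod.splits dest: letter_step_inv)

lemma inv_letter_inv [simp]: "inv_letter (inv_letter a) = a"
  by (cases a) auto

lemma inv_word_simps [simp]: "inv_word [] = []" "inv_word (a # w) = inv_word w @ [inv_letter a]"
  by (auto simp: inv_word_def)

lemma inv_word_append [simp]: "inv_word (v @ w) = inv_word w @ inv_word v"
  by (simp add: inv_word_def)

lemma inv_word_inv [simp]: "inv_word (inv_word w) = w"
  by (induction w) auto

lemma word_map_inv [simp]: "word_map A (inv_word w) (word_map A w u) = u"
proof (induction w arbitrary: u)
  case (Cons a w)
  then show ?case
    by (simp add: word_map_append word_map_Cons[of A a w] word_map_inv_letter)
qed simp

lemma word_map_inv' [simp]: "word_map A w (word_map A (inv_word w) u) = u"
  using word_map_inv[of A "inv_word w" u] by simp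

section \<open>Automaton groups and conjugation\<close>

lemma mult_automaton_group [simp]: "x \<otimes>\<^bsub>automaton_group A\<^esub> y = x \<circ> y"
  by (simp add: automaton_group_def tree_aut_def)

text \<open>Replaces the generated subgroup by something computable. The point beyond closure under
  composition is that the inverse taken in \<open>tree_aut\<close> agrees with the recursive action
  of \<open>Neg q\<close>: a left inverse and a right inverse of the same map coincide.\<close>

lemma carrier_automaton_group: "carrier (automaton_group A) = range (word_map A)"
proof -
  interpret T: group tree_aut by (rule group_tree_aut)
  have S: "carrier tree_aut \<inter> range (state_map A) = range (state_map A)"
    using state_map_in_tree_aut by auto
  have inv_state: "inv\<^bsub>tree_aut\<^esub> (state_map A q) = word_map A [Neg q]" for q
  proof -
    let ?i = "inv\<^bsub>tree_aut\<^esub> (state_map A q)"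
    have "?i \<circ> state_map A q = id"
      using T.l_inv[OF state_map_in_tree_aut[of A q]] by (simp add: tree_aut_def)
    then have i: "?i (state_map A q u) = u" for u by (simp add: fun_eq_iff)
    have "state_map A q (word_map A [Neg q] u) = u" for u
      using word_map_inv_letter[of A "Neg q" u] by (simp add: word_map_Pos)
    then show ?thesis using i[of "word_map A [Neg q] u" for u] by (simp add: fun_eq_iff)
  qed
  have "f \<in> range (word_map A)" if "f \<in> generate tree_aut (range (state_map A))" for f
    using that
  proof (induction rule: generate.induct)
    case one
    have "\<one>\<^bsub>tree_aut\<^esub> = word_map A []" by (simp add: tree_aut_def)
    then show ?case by (metis rangeI)
  next
    case (incl h)
    then obtain q where "h = word_map A [Pos q]" by (auto simp: word_map_Pos)
    then show ?case by simp
  next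
    case (inv h)
    then show ?case using inv_state by auto
  next
    case (eng f g)
    then obtain v w where "f = word_map A v" "g = word_map A w" by auto
    then have "f \<circ> g = word_map A (w @ v)" by (simp add: fun_eq_iff word_map_append)
    then show ?case by (simp add: tree_aut_def)
  qed
  moreover have "word_map A w \<in> generate tree_aut (range (state_map A))" for w
  proof (induction w)
    case Nil
    have "word_map A [] = \<one>\<^bsub>tree_aut\<^esub>" by (simp add: tree_aut_def)
    then show ?case by (metis generate.one)
  next
    case (Cons a w)
    have "word_map A [a] \<in> generate tree_aut (range (state_map A))"
    proof (cases a)
      case (Pos q)
      then show ?thesis by (simp add: word_map_Pos generate.incl)
    next
      case (Neg q)
      then show ?thesis using generate.inv[of "state_map A q" "range (state_map A)" tree_aut]
        by (simp add: inv_state)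
    qed
    then have "word_map A w \<otimes>\<^bsub>tree_aut\<^esub> word_map A [a] \<in> generate tree_aut (range (state_map A))"
      using Cons generate.eng by metis
    moreover have "word_map A w \<otimes>\<^bsub>tree_aut\<^esub> word_map A [a] = word_map A (a # w)"
      by (simp add: tree_aut_def fun_eq_iff word_map_Cons[of A a w])
    ultimately show ?case by simp
  qed
  ultimately show ?thesis
    by (auto simp: automaton_group_def subgroup_generated_def S)
qed

fun subst_letter :: "(state \<Rightarrow> group_word) \<Rightarrow> letter \<Rightarrow> group_word" where
  "subst_letter W (Pos q) = W q"
| "subst_letter W (Neg q) = inv_word (W q)"

definition subst_word :: "(state \<Rightarrow> group_word) \<Rightarrow> group_word \<Rightarrow> group_word" where
  "subst_word W w = concat (map (subst_letter W) w)"

definition isomorphic :: "automaton \<Rightarrow> automaton \<Rightarrow> bool" where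
  "isomorphic A B \<longleftrightarrow> automaton_group A \<cong> automaton_group B"

lemma isomorphic_refl [simp]: "isomorphic A A"
  by (simp add: isomorphic_def iso_refl)

lemma isomorphic_sym: "isomorphic A B \<Longrightarrow> isomorphic B A"
  unfolding isomorphic_def using group.iso_sym[OF group_automaton_group] by blast

lemma isomorphic_trans [trans]: "isomorphic A B \<Longrightarrow> isomorphic B C \<Longrightarrow> isomorphic A C"
  unfolding isomorphic_def by (rule iso_trans)

text \<open>Conjugation by a bijection \<open>h\<close> is injective and respects composition.
  \<open>W\<close> makes it send the generators of the first group into the second group, and
  \<open>V\<close> writes every generator of the second group in terms of these images, which gives
  surjectivity.\<close>

lemma isomorphic_conjugate:
  assumes h: "bij h"
    and W: "\<And>q u. h (state_map A q u) = word_map B (W q) (h u)"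
    and V: "\<And>q. word_map B (subst_word W (V q)) = state_map B q"
  shows "isomorphic A B"
proof -
  define \<phi> where "\<phi> f = h \<circ> f \<circ> inv_into UNIV h" for f :: "bool list \<Rightarrow> bool list"
  have h1 [simp]: "inv_into UNIV h (h u) = u" and h2 [simp]: "h (inv_into UNIV h u) = u" for u
    using h by (simp_all add: bij_is_inj bij_is_surj surj_f_inv_f)
  have "h (word_map A [Neg q] u) = word_map B (inv_word (W q)) (h u)" for q u
  proof -
    have "state_map A q (word_map A [Neg q] u) = u"
      using word_map_inv_letter[of A "Neg q" u] by (simp add: word_map_Pos)
    then show ?thesis using W[of q "word_map A [Neg q] u"] by (metis word_map_inv)
  qed
  then have letter: "h (word_map A [a] u) = word_map B (subst_letter W a) (h u)" for a u
    using W by (cases a) (auto simp: word_map_Pos)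
  have word: "h (word_map A w u) = word_map B (subst_word W w) (h u)" for w u
  proof (induction w arbitrary: u)
    case (Cons a w)
    have "h (word_map A (a # w) u) = h (word_map A w (word_map A [a] u))"
      by (simp only: word_map_Cons[of A a w])
    then show ?case by (simp add: Cons letter subst_word_def word_map_append)
  qed (simp add: subst_word_def)
  have \<phi>_word: "\<phi> (word_map A w) = word_map B (subst_word W w)" for w
    by (auto simp: \<phi>_def word)
  have letter': "word_map B (subst_word W (subst_letter V a)) = word_map B [a]" for a
  proof (cases a)
    case (Pos q)
    then show ?thesis by (simp add: V word_map_Pos)
  next
    case (Neg q)
    have "subst_letter W (inv_letter b) = inv_word (subst_letter W b)" for b
      by (cases b) auto
    then have "subst_word W (inv_word v) = inv_word (subst_word W v)" for v
      by (induction v) (auto simp: subst_word_def inv_word_def)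
    moreover have "word_map B (inv_word (subst_word W (V q))) u = word_map B [Neg q] u" for u
    proof -
      have "state_map B q (word_map B [Neg q] u) = u"
        using word_map_inv_letter[of B "Neg q" u] by (simp add: word_map_Pos)
      then show ?thesis by (metis V word_map_inv)
    qed
    ultimately show ?thesis using Neg by auto
  qed
  have word': "word_map B (subst_word W (subst_word V w)) = word_map B w" for w
  proof (induction w)
    case (Cons a w)
    have "subst_word W (subst_word V (a # w)) =
        subst_word W (subst_letter V a) @ subst_word W (subst_word V w)"
      by (simp add: subst_word_def)
    then show ?case
      by (simp add: fun_eq_iff word_map_append letter' Cons word_map_Cons[of B a w])
  qed (simp add: subst_word_def)
  have "inj \<phi>"
  proof (rule injI, rule ext)
    fix f g u assume "\<phi> f = \<phi> g"
    then have "\<phi> f (h u) = \<phi> g (h u)" by simp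
    then show "f u = g u" using h by (simp add: \<phi>_def bij_is_inj inj_eq)
  qed
  moreover have "\<phi> ` range (word_map A) = range (word_map B)"
  proof
    show "\<phi> ` range (word_map A) \<subseteq> range (word_map B)" by (auto simp: \<phi>_word)
    show "range (word_map B) \<subseteq> \<phi> ` range (word_map A)"
      by (metis (no_types, lifting) \<phi>_word word' image_eqI image_subset_iff rangeI)
  qed
  ultimately have "bij_betw \<phi> (range (word_map A)) (range (word_map B))"
    by (auto simp: bij_betw_def intro: inj_on_subset)
  moreover have "\<phi> (f \<circ> g) = \<phi> f \<circ> \<phi> g" for f g
    by (auto simp: \<phi>_def)
  ultimately have "\<phi> \<in> iso (automaton_group A) (automaton_group B)"
    by (auto simp: iso_def hom_def carrier_automaton_group bij_betw_def)
  then show ?thesis by (auto simp: isomorphic_def is_iso_def)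
qed

section \<open>Deciding triviality of words\<close>

definition cancel :: "letter \<Rightarrow> group_word \<Rightarrow> group_word" where
  "cancel a w = (case w of [] \<Rightarrow> [a] | b # v \<Rightarrow> if b = inv_letter a then v else a # w)"

text \<open>Free reduction lets the search meet fewer distinct words and stop at once on those that
  are trivial in the free group.\<close>

definition reduce :: "group_word \<Rightarrow> group_word" where
  "reduce w = foldr cancel w []"

lemma word_map_reduce: "word_map A (reduce w) u = word_map A w u"
proof (induction w arbitrary: u)
  case (Cons a w)
  have "word_map A (cancel a v) u = word_map A (a # v) u" for v
  proof (cases v)
    case (Cons b v')
    then show ?thesis
      using word_map_inv_letter[of A a u]
      by (auto simp: cancel_def word_map_Cons[of A a "b # v'"] word_map_Cons[of A b v'])
  qed (simp add: cancel_def)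
  from this[of "reduce w"] show ?case
    by (simp add: Cons[unfolded reduce_def] reduce_def word_map_Cons[of A a w] word_map_Cons[of A a "foldr cancel w []"])
qed (simp add: reduce_def)

definition step_trivial :: "automaton \<Rightarrow> group_word \<Rightarrow> bool" where
  "step_trivial A w \<longleftrightarrow> \<not> fst (word_step A False w) \<and> fst (word_step A True w)"

definition sections :: "automaton \<Rightarrow> group_word \<Rightarrow> group_word list" where
  "sections A w = [snd (word_step A False w), snd (word_step A True w)]"

\<comment> \<open>The search returns \<open>None\<close> (rather than \<open>False\<close>) on failure, so that nontermination is
  harmless: \<open>Some ()\<close> is only reached when \<open>seen\<close> has become closed under sections.\<close>
partial_function (option)
  search :: "automaton \<Rightarrow> group_word list \<Rightarrow> group_word list \<Rightarrow> unit option" where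
  [code]: "search A seen ws =
    (case ws of [] \<Rightarrow> Some ()
     | w # ws' \<Rightarrow>
        if reduce w = [] \<or> reduce w \<in> set seen then search A seen ws'
        else if step_trivial A (reduce w)
          then search A (reduce w # seen) (sections A (reduce w) @ ws')
        else None)"

definition trivial_word :: "automaton \<Rightarrow> group_word \<Rightarrow> bool" where
  "trivial_word A w \<longleftrightarrow> search A [] [w] = Some ()"

text \<open>Invariant of the search. Words in \<open>seen\<close> are exempt from the closure
  condition because their sections were queued when they were recorded. For empty
  \<open>seen\<close> nothing is exempt: every member of \<open>R\<close> fixes both letters, and
  \<open>R\<close> is closed under sections up to free reduction and the empty word.\<close>

definition section_closure ::
    "automaton \<Rightarrow> group_word list \<Rightarrow> group_word list \<Rightarrow> group_word set \<Rightarrow> bool" where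
  "section_closure A seen ws R \<longleftrightarrow> set seen \<subseteq> R \<and> (\<forall>w\<in>set ws. reduce w \<in> insert [] R) \<and>
    (\<forall>w\<in>R - set seen. step_trivial A w \<and> (\<forall>v\<in>set (sections A w). reduce v \<in> insert [] R))"

text \<open>Fixpoint induction: the claim concerns only calls that return \<open>Some\<close>, so it
  passes from the approximations \<open>f\<close> to \<open>search\<close> without a termination
  proof. The set \<open>R\<close> is existential because the search does not return the words it has
  recorded.\<close>

lemma search_sound: "search A seen ws = Some r \<Longrightarrow> \<exists>R. section_closure A seen ws R"
proof (erule search.raw_induct[rotated])
  fix f A seen ws and r :: unit
  assume IH: "\<And>A seen ws r. f A seen ws = Some r \<Longrightarrow> \<exists>R. section_closure A seen ws R"
    and eq: "(case ws of [] \<Rightarrow> Some ()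
     | w # ws' \<Rightarrow>
        if reduce w = [] \<or> reduce w \<in> set seen then f A seen ws'
        else if step_trivial A (reduce w)
          then f A (reduce w # seen) (sections A (reduce w) @ ws')
        else None) = Some r"
  show "\<exists>R. section_closure A seen ws R"
  proof (cases ws)
    case Nil
    then have "section_closure A seen ws (set seen)" by (simp add: section_closure_def)
    then show ?thesis by blast
  next
    case (Cons w ws')
    show ?thesis
    proof (cases "reduce w = [] \<or> reduce w \<in> set seen")
      case True
      then have "f A seen ws' = Some r" using eq Cons by auto
      then obtain R where "section_closure A seen ws' R" using IH by blast
      then have "section_closure A seen ws R" using True Cons by (auto simp: section_closure_def)
      then show ?thesis by blast
    next
      case False
      then have st: "step_trivial A (reduce w)"
        and s: "f A (reduce w # seen) (sections A (reduce w) @ ws') = Some r"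
        using eq Cons by (auto split: if_splits)
      from s obtain R where "section_closure A (reduce w # seen) (sections A (reduce w) @ ws') R"
        using IH by blast
      \<comment> \<open>Here \<open>reduce w\<close> loses its exemption; \<open>st\<close> and its
        queued sections provide the missing condition.\<close>
      then have "section_closure A seen ws R" using st Cons by (auto simp: section_closure_def)
      then show ?thesis by blast
    qed
  qed
qed

text \<open>A nonempty word in the closed set fixes the first letter and hands the tail to a word
  that is, after free reduction, empty or in the set again. Induction on the input then shows that
  nothing is moved.\<close>

lemma trivial_word_sound:
  assumes "trivial_word A w"
  shows "word_map A w = id"
proof -
  obtain R where R: "reduce w \<in> insert [] R"
    "\<And>v. v \<in> R \<Longrightarrow> step_trivial A v \<and> (\<forall>v'\<in>set (sections A v). reduce v' \<in> insert [] R)"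
    using search_sound[of A "[]" "[w]"] assms
    unfolding trivial_word_def section_closure_def by auto
  have "v \<in> insert [] R \<Longrightarrow> word_map A v u = u" for v u
  proof (induction u arbitrary: v)
    case (Cons x u)
    show ?case
    proof (cases "v = []")
      case False
      then have "v \<in> R" using Cons.prems by simp
      then have "fst (word_step A x v) = x" "reduce (snd (word_step A x v)) \<in> insert [] R"
        using R(2) by (cases x; auto simp: step_trivial_def sections_def)+
      then have "word_map A (snd (word_step A x v)) u = u"
        using Cons.IH word_map_reduce by metis
      with \<open>fst (word_step A x v) = x\<close> show ?thesis by (auto split: prod.splits)
    qed simp
  qed simp
  then show ?thesis using R(1) word_map_reduce by (metis eq_id_iff)
qed

section \<open>Conjugacy certificates\<close>

text \<open>
  A certificate for \<open>isomorphic A B\<close> lists tree automorphisms \<open>h\<^sub>0, h\<^sub>1, \<dots>\<close> by their wreath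
  recursion: an entry \<open>(e, j, g, g', W)\<close> stands for \<open>h\<^sub>i = \<sigma>\<^sup>e (h\<^sub>j g, h\<^sub>j g')\<close>, where \<open>g\<close> and \<open>g'\<close>
  are words over \<open>B\<close>, together with the claim that \<open>h\<^sub>i\<close> conjugates every state \<open>q\<close> of \<open>A\<close> to \<open>W q\<close>.
  The claim for \<open>h\<^sub>i\<close> at level \<open>n + 1\<close> follows from the claim for \<open>h\<^sub>j\<close> at level \<open>n\<close> and the
  triviality of some words over \<open>B\<close>. For \<open>i > 0\<close> it is needed only for those states that occur as
  sections.
\<close>

definition on_state :: "'a \<times> 'a \<times> 'a \<Rightarrow> state \<Rightarrow> 'a" where
  "on_state = (\<lambda>(x, y, z) q. case q of S1 \<Rightarrow> x | S2 \<Rightarrow> y | S3 \<Rightarrow> z)"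

type_synonym conjugator =
  "bool \<times> nat \<times> group_word \<times> group_word \<times> (group_word \<times> group_word \<times> group_word)"

text \<open>The coefficient is chosen by the input letter and applied after the \<open>j\<close>-th
  conjugator. If entry 0 is \<open>(False, 0, [], [], W)\<close>, the map is the identity, so
  certificates also cover automata whose states are words over \<open>B\<close> as they stand;
  \<open>(True, 0, [], [], W)\<close> exchanges the two letters throughout.\<close>

fun conj_map :: "automaton \<Rightarrow> conjugator list \<Rightarrow> nat \<Rightarrow> bool list \<Rightarrow> bool list" where
  "conj_map B C i [] = []"
| "conj_map B C i (x # u) =
     (case C ! i of (e, j, g, g', W) \<Rightarrow>
        (x \<noteq> e) # word_map B (if x then g' else g) (conj_map B C j u))"

lemma length_conj_map [simp]: "length (conj_map B C i u) = length u"
  by (induction u arbitrary: i) (auto split: prod.splits)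

lemma bij_conj_map: "bij (conj_map B C i)"
proof -
  have "conj_map B C i u = conj_map B C i v \<Longrightarrow> u = v" for u v
  proof (induction u arbitrary: i v)
    case Nil
    then show ?case by (metis length_0_conv length_conj_map)
  next
    case (Cons x u)
    then obtain y v' where v: "v = y # v'"
      by (metis length_0_conv length_conj_map list.exhaust list.distinct(1))
    obtain e j g g' W where Ci: "C ! i = (e, j, g, g', W)" by (metis prod_cases5)
    from Cons.prems have "y = x"
      and "word_map B (if x then g' else g) (conj_map B C j u) =
        word_map B (if x then g' else g) (conj_map B C j v')"
      by (auto simp: v Ci)
    then show ?case using Cons.IH v by (metis word_map_inv)
  qed
  moreover have "\<exists>u. conj_map B C i u = v" for v
  \<comment> \<open>The tail to be hit is changed to \<open>word_map B (inv_word k) v'\<close>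
    before the induction hypothesis applies. It keeps only its length, hence the induction on the
    length.\<close>
  proof (induction "length v" arbitrary: i v)
    case 0
    then show ?case by (intro exI[of _ "[]"]) simp
  next
    case (Suc n)
    obtain y v' where v: "v = y # v'" using Suc.hyps(2) by (cases v) auto
    obtain e j g g' W where Ci: "C ! i = (e, j, g, g', W)" by (metis prod_cases5)
    \<comment> \<open>\<open>y \<noteq> e\<close> is the input letter that produces the output
      letter \<open>y\<close>.\<close>
    define k where "k = (if y \<noteq> e then g' else g)"
    obtain u where "conj_map B C j u = word_map B (inv_word k) v'"
      using Suc.hyps v by (metis length_Cons length_word_map nat.inject)
    then have "word_map B k (conj_map B C j u) = v'" by simp
    then show ?case
      by (intro exI[of _ "(y \<noteq> e) # u"]) (auto simp: v Ci k_def)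
  qed
  ultimately show ?thesis unfolding bij_def inj_def surj_def by metis
qed

text \<open>Deeper in the recursion a state that is not a section of any state never has to be
  matched, and its conjugate may even lie outside the group of the second automaton. The
  certificates put \<open>[]\<close> in such places.\<close>

definition claimed_states :: "automaton \<Rightarrow> nat \<Rightarrow> state list" where
  "claimed_states A i =
     (if i = 0 then [S1, S2, S3]
      else concat (map (\<lambda>q. case A q of (s, l, r) \<Rightarrow> [l, r]) [S1, S2, S3]))"

text \<open>Both sides of the claim for \<open>q\<close> are applied to an input starting with
  \<open>x\<close>; let \<open>p\<close> be the section of \<open>q\<close> at \<open>x\<close>.
  Applying \<open>q\<close> and then the conjugator leaves the tail to the word \<open>W'\<close> of
  \<open>p\<close> followed by the coefficient at \<open>x \<noteq> s\<close>; the other order gives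
  the coefficient at \<open>x\<close> followed by \<open>v\<close>. Both act on the image of the
  tail under the \<open>j\<close>-th conjugator, so these two words over \<open>B\<close> have to
  agree.\<close>

definition check_section ::
    "automaton \<Rightarrow> automaton \<Rightarrow> conjugator list \<Rightarrow> conjugator \<Rightarrow> state \<Rightarrow> bool \<Rightarrow> bool" where
  "check_section A B C c q x =
     (case c of (e, j, g, g', W) \<Rightarrow> case C ! j of (_, _, _, _, W') \<Rightarrow>
      case A q of (s, l, r) \<Rightarrow> case word_step B (x \<noteq> e) (on_state W q) of (y, v) \<Rightarrow>
        y = ((x \<noteq> s) \<noteq> e) \<and>
        trivial_word B (on_state W' (if x then r else l) @ (if x \<noteq> s then g' else g) @
          inv_word v @ inv_word (if x then g' else g)))"

definition check_conjugator ::
    "automaton \<Rightarrow> automaton \<Rightarrow> conjugator list \<Rightarrow> nat \<Rightarrow> bool" where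
  "check_conjugator A B C i =
     (fst (snd (C ! i)) < length C \<and>
      list_all (\<lambda>q. check_section A B C (C ! i) q False \<and> check_section A B C (C ! i) q True)
        (claimed_states A i))"

definition check_generators ::
    "automaton \<Rightarrow> (state \<Rightarrow> group_word) \<Rightarrow> (state \<Rightarrow> group_word) \<Rightarrow> bool" where
  "check_generators B W V =
     list_all (\<lambda>q. trivial_word B (subst_word W (V q) @ [Neg q])) [S1, S2, S3]"

definition first_words :: "conjugator list \<Rightarrow> state \<Rightarrow> group_word" where
  "first_words C = (case C ! 0 of (_, _, _, _, W) \<Rightarrow> on_state W)"

type_synonym rows = "(bool \<times> state \<times> state) \<times> (bool \<times> state \<times> state) \<times> (bool \<times> state \<times> state)"

\<comment> \<open>The last component expresses the states of the second automaton by the images of the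
  states of the first one.\<close>
type_synonym conjugacy =
  "rows \<times> rows \<times> conjugator list \<times> (group_word \<times> group_word \<times> group_word)"

definition check_conjugacy :: "conjugacy \<Rightarrow> bool" where
  "check_conjugacy = (\<lambda>(a, b, C, V).
     C \<noteq> [] \<and> list_all (check_conjugator (on_state a) (on_state b) C) [0..<length C] \<and>
     check_generators (on_state b) (first_words C) (on_state V))"

section \<open>Soundness of the certificates\<close>

lemma word_map_eqI:
  assumes "trivial_word B (v @ inv_word w)"
  shows "word_map B v = word_map B w"
proof
  fix u
  have "word_map B (inv_word w) (word_map B v u) = u"
    using trivial_word_sound[OF assms] word_map_append by (metis id_apply)
  then show "word_map B v u = word_map B w u" by (metis word_map_inv')
qed

text \<open>One induction on the input serves all entries at once: the claim for entry
  \<open>i\<close> uses entry \<open>j\<close> on the shorter tail, so the references between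
  entries may run in cycles.\<close>

lemma conj_map_state_map:
  assumes "\<And>i. i < length C \<Longrightarrow> check_conjugator A B C i"
    and "i < length C" and "q \<in> set (claimed_states A i)" and "C ! i = (e, j, g, g', W)"
  shows "conj_map B C i (state_map A q u) = word_map B (on_state W q) (conj_map B C i u)"
  using assms(2-)
proof (induction u arbitrary: i q e j g g' W)
  case (Cons x u)
  obtain e' j' k k' W' where Cj: "C ! j = (e', j', k, k', W')" by (metis prod_cases5)
  obtain s l r where Aq: "A q = (s, l, r)" by (metis prod_cases3)
  obtain y v where step: "word_step B (x \<noteq> e) (on_state W q) = (y, v)"
    by (cases "word_step B (x \<noteq> e) (on_state W q)")
  define p where "p = (if x then r else l)"
  define gx where "gx = (if x then g' else g)"
  define gy where "gy = (if x \<noteq> s then g' else g)"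
  note Ci = Cons.prems(3)
  have chk: "check_conjugator A B C i" using assms(1) Cons.prems(1) by blast
  then have j: "j < length C" by (simp add: check_conjugator_def Ci)
  have "check_section A B C (C ! i) q x"
    using chk Cons.prems(2) unfolding check_conjugator_def list_all_iff by (cases x) simp_all
  then have "y = ((x \<noteq> s) \<noteq> e) \<and>
      trivial_word B (on_state W' p @ gy @ inv_word v @ inv_word gx)"
    unfolding check_section_def Ci Cj Aq p_def gx_def gy_def by (simp only: step Cj Aq prod.case)
  then have y: "y = ((x \<noteq> s) \<noteq> e)"
    and "trivial_word B ((on_state W' p @ gy) @ inv_word (gx @ v))"
    by simp_all
  then have eq: "word_map B (on_state W' p @ gy) = word_map B (gx @ v)"
    by (intro word_map_eqI)
  \<comment> \<open>For \<open>j = 0\<close> every state is claimed, and for other \<open>j\<close>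
    every section is.\<close>
  have "p \<in> set (claimed_states A j)"
  proof -
    have "p \<in> {S1, S2, S3}" by (cases p) simp_all
    moreover have "p \<in> set (case A q of (s, l, r) \<Rightarrow> [l, r])" by (simp add: Aq p_def)
    then have "p \<in> set (concat (map (\<lambda>q. case A q of (s, l, r) \<Rightarrow> [l, r]) [S1, S2, S3]))"
      by (cases q) simp_all
    ultimately show ?thesis by (simp add: claimed_states_def)
  qed
  from Cons.IH[OF j this Cj] have IH: "conj_map B C j (state_map A p u) =
      word_map B (on_state W' p) (conj_map B C j u)" .
  have "conj_map B C i (state_map A q (x # u)) =
      y # word_map B gy (conj_map B C j (state_map A p u))"
    by (simp add: Aq Ci gy_def p_def y)
  also have "\<dots> = y # word_map B v (word_map B gx (conj_map B C j u))"
    by (simp add: IH fun_cong[OF eq] flip: word_map_append)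
  also have "\<dots> = word_map B (on_state W q) (conj_map B C i (x # u))"
    by (simp only: conj_map.simps word_map.simps Ci prod.case gx_def step)
  finally show ?case .
qed simp

lemma check_conjugacy_sound:
  assumes "check_conjugacy (a, b, C, V)"
  shows "isomorphic (on_state a) (on_state b)"
proof (rule isomorphic_conjugate[where h = "conj_map (on_state b) C 0" and W = "first_words C"
      and V = "on_state V"])
  show "bij (conj_map (on_state b) C 0)" by (rule bij_conj_map)
next
  fix q u
  obtain e j g g' W where C0: "C ! 0 = (e, j, g, g', W)" by (metis prod_cases5)
  have "q \<in> set (claimed_states (on_state a) 0)" by (cases q) (auto simp: claimed_states_def)
  then show "conj_map (on_state b) C 0 (state_map (on_state a) q u) =
      word_map (on_state b) (first_words C q) (conj_map (on_state b) C 0 u)"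
    using assms C0 conj_map_state_map[of C "on_state a" "on_state b" 0 q e j g g' W u]
    by (auto simp: check_conjugacy_def first_words_def list_all_iff)
next
  fix q
  have "trivial_word (on_state b) (subst_word (first_words C) (on_state V q) @ inv_word [Pos q])"
    using assms by (cases q) (simp_all add: check_conjugacy_def check_generators_def)
  then show "word_map (on_state b) (subst_word (first_words C) (on_state V q)) =
      state_map (on_state b) q"
    using word_map_eqI word_map_Pos by metis
qed

section \<open>Symmetries\<close>

text \<open>\<open>\<pi>\<close> serves both to look up a row and to rename its targets. This is
  right for involutions, and transpositions are the only renamings used below.\<close>

definition rename :: "(state \<Rightarrow> state) \<Rightarrow> automaton \<Rightarrow> automaton" where
  "rename \<pi> A q = (case A (\<pi> q) of (s, l, r) \<Rightarrow> (s, \<pi> l, \<pi> r))"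

text \<open>For \<open>t = True\<close> this is the automaton of the inverse states, since inverting
  an active state swaps its two sections. For \<open>t = False\<close> the inversion is combined
  with the exchange of the letters: on active states the two swaps of the sections cancel, on
  inactive states only the exchange swaps them.\<close>

definition mirror :: "bool \<Rightarrow> automaton \<Rightarrow> automaton" where
  "mirror t A q = (case A q of (s, l, r) \<Rightarrow> if s = t then (s, r, l) else (s, l, r))"

lemma isomorphic_rename:
  assumes "\<And>q. \<pi> (\<pi> q) = q"
  shows "isomorphic A (rename \<pi> A)"
proof -
  have *: "state_map (rename \<pi> A) q u = state_map A (\<pi> q) u" for q u
    by (induction u arbitrary: q) (auto simp: rename_def assms split: prod.splits)
  show ?thesis
    by (rule isomorphic_conjugate[where h = id and W = "\<lambda>q. [Pos (\<pi> q)]"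
          and V = "\<lambda>q. [Pos (\<pi> q)]"])
      (auto simp: word_map_Pos * assms subst_word_def)
qed

lemma state_map_mirror_True: "state_map (mirror True A) q (state_map A q u) = u"
proof (induction u arbitrary: q)
  case (Cons x u)
  obtain s l r where "A q = (s, l, r)" by (metis prod_cases3)
  then show ?case using Cons by (cases s; cases x) (simp_all add: mirror_def)
qed simp

lemma state_map_mirror_False:
  "state_map (mirror False A) q (map Not (state_map A q u)) = map Not u"
proof (induction u arbitrary: q)
  case (Cons x u)
  obtain s l r where "A q = (s, l, r)" by (metis prod_cases3)
  then show ?case using Cons by (cases s; cases x) (simp_all add: mirror_def)
qed simp

text \<open>Each state is conjugate to the inverse of the mirrored state of the same name, by the
  identity or by the exchange of the letters.\<close>

lemma isomorphic_mirror: "isomorphic A (mirror t A)"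
proof -
  define h :: "bool list \<Rightarrow> bool list" where "h = (if t then id else map Not)"
  have hh: "h (h u) = u" for u by (auto simp: h_def comp_def)
  have *: "state_map (mirror t A) q (h (state_map A q u)) = h u" for q u
    by (cases t) (simp_all add: h_def state_map_mirror_True state_map_mirror_False)
  have W: "h (state_map A q u) = word_map (mirror t A) [Neg q] (h u)" for q u
    using word_map_inv_letter[of "mirror t A" "Pos q" "h (state_map A q u)"]
    by (simp add: word_map_Pos *)
  have "bij h" by (rule o_bij[of h]) (auto simp: hh)
  then show ?thesis
    by (rule isomorphic_conjugate[where V = "\<lambda>q. [Neg q]", OF _ W])
      (simp add: subst_word_def word_map_Pos)
qed

fun exchange :: "state \<times> state \<Rightarrow> state \<Rightarrow> state" where
  "exchange (p, p') q = (if q = p then p' else if q = p' then p else q)"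

section \<open>The table of conjugacies\<close>

text \<open>
  Found by computer search: generating tuples were enumerated by Nielsen moves, compared by their
  labelled Schreier graphs on a deep level of the tree, and then matched by solving for the wreath
  recursion of the conjugator. The second automaton of an entry is a representative or the first
  automaton of an earlier entry.
\<close>

definition conjugacies_1 :: "conjugacy list" where
  "conjugacies_1 = [
  (((True,S1,S1),(True,S1,S1),(False,S1,S1)), ((True,S1,S1),(False,S1,S1),(False,S1,S1)),
    [(False, 0, [], [], ([Pos S1],[Pos S1],[Pos S2]))],
    ([Pos S1],[Pos S3],[Pos S3])),
  (((True,S2,S1),(True,S1,S1),(False,S1,S1)), ((True,S1,S1),(False,S1,S1),(False,S1,S1)),
    [(False, 0, [], [], ([Pos S1],[Pos S1],[Pos S2]))],
    ([Pos S1],[Pos S3],[Pos S3])),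
  (((True,S2,S2),(True,S1,S1),(False,S1,S1)), ((True,S1,S1),(False,S1,S1),(False,S1,S1)),
    [(False, 0, [], [], ([Pos S1],[Pos S1],[Pos S2]))],
    ([Pos S1],[Pos S3],[Pos S3])),
  (((True,S1,S1),(True,S2,S1),(False,S1,S1)), ((True,S1,S1),(False,S1,S1),(False,S1,S1)),
    [(False, 0, [], [], ([Pos S1],[Pos S1],[Pos S2]))],
    ([Pos S1],[Pos S3],[Pos S3])),
  (((True,S2,S1),(True,S2,S1),(False,S1,S1)), ((True,S1,S1),(False,S1,S1),(False,S1,S1)),
    [(False, 0, [], [], ([Pos S1],[Pos S1],[Pos S2]))],
    ([Pos S1],[Pos S3],[Pos S3])),
  (((True,S1,S2),(True,S2,S1),(False,S1,S1)), ((True,S1,S1),(False,S1,S1),(False,S1,S1)),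
    [(False, 0, [], [], ([Pos S1],[Pos S1],[Pos S2]))],
    ([Pos S1],[Pos S3],[Pos S3])),
  (((True,S2,S2),(True,S2,S1),(False,S1,S1)), ((True,S1,S1),(False,S1,S1),(False,S1,S1)),
    [(False, 0, [], [], ([Pos S1],[Pos S1],[Pos S2]))],
    ([Pos S1],[Pos S3],[Pos S3])),
  (((True,S1,S1),(True,S2,S2),(False,S1,S1)), ((True,S1,S1),(False,S1,S1),(False,S1,S1)),
    [(False, 0, [], [], ([Pos S1],[Pos S1],[Pos S2]))],
    ([Pos S1],[Pos S3],[Pos S3])),
  (((True,S2,S1),(True,S2,S2),(False,S1,S1)), ((True,S1,S1),(False,S1,S1),(False,S1,S1)),
    [(False, 0, [], [], ([Pos S1],[Pos S1],[Pos S2]))],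
    ([Pos S1],[Pos S3],[Pos S3])),
  (((True,S2,S2),(True,S2,S2),(False,S1,S1)), ((True,S1,S1),(False,S1,S1),(False,S1,S1)),
    [(False, 0, [], [], ([Pos S1],[Pos S1],[Pos S2]))],
    ([Pos S1],[Pos S3],[Pos S3])),
  (((True,S1,S1),(True,S1,S1),(False,S2,S1)), ((True,S1,S1),(False,S1,S1),(False,S1,S1)),
    [(False, 0, [], [], ([Pos S1],[Pos S1],[Pos S2]))],
    ([Pos S1],[Pos S3],[Pos S3])),
  (((True,S2,S1),(True,S1,S1),(False,S2,S1)), ((True,S1,S1),(False,S1,S1),(False,S1,S1)),
    [(False, 0, [], [], ([Pos S1],[Pos S1],[Pos S2]))],
    ([Pos S1],[Pos S3],[Pos S3])),
  (((True,S2,S2),(True,S1,S1),(False,S2,S1)), ((True,S1,S1),(False,S1,S1),(False,S1,S1)),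
    [(False, 0, [], [], ([Pos S1],[Pos S1],[Pos S2]))],
    ([Pos S1],[Pos S3],[Pos S3])),
  (((True,S1,S1),(True,S2,S1),(False,S2,S1)), ((True,S1,S1),(False,S1,S1),(False,S1,S1)),
    [(False, 0, [], [], ([Pos S1],[Pos S1],[Pos S2]))],
    ([Pos S1],[Pos S3],[Pos S3])),
  (((True,S2,S1),(True,S2,S1),(False,S2,S1)), ((True,S1,S1),(False,S1,S1),(False,S1,S1)),
    [(False, 0, [], [], ([Pos S1],[Pos S1],[Pos S2]))],
    ([Pos S1],[Pos S3],[Pos S3])),
  (((True,S1,S2),(True,S2,S1),(False,S2,S1)), ((True,S1,S1),(False,S1,S1),(False,S1,S1)),
    [(False, 0, [], [], ([Pos S1],[Pos S1],[Pos S2]))],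
    ([Pos S1],[Pos S3],[Pos S3])),
  (((True,S1,S1),(True,S2,S2),(False,S2,S1)), ((True,S1,S1),(False,S1,S1),(False,S1,S1)),
    [(False, 0, [], [], ([Pos S1],[Pos S1],[Pos S2]))],
    ([Pos S1],[Pos S3],[Pos S3])),
  (((True,S2,S2),(False,S1,S1),(False,S1,S1)), ((True,S1,S1),(False,S1,S1),(False,S1,S1)),
    [(False, 0, [], [Neg S2,Pos S1], ([Pos S1],[Pos S2],[Pos S2]))],
    ([Pos S1],[Pos S2],[Pos S2])),
  (((True,S3,S2),(False,S1,S1),(False,S1,S1)), ((True,S1,S1),(False,S1,S1),(False,S1,S1)),
    [(False, 0, [], [Neg S2,Pos S1], ([Pos S1],[Pos S2],[Pos S2]))],
    ([Pos S1],[Pos S2],[Pos S2])),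
  (((True,S3,S3),(True,S3,S3),(False,S1,S1)), ((True,S1,S1),(False,S1,S1),(False,S1,S1)),
    [(False, 0, [], [Neg S2,Pos S1], ([Pos S1],[Pos S1],[Pos S2]))],
    ([Pos S1],[Pos S3],[Pos S3])),
  (((True,S3,S3),(True,S3,S3),(False,S2,S1)), ((True,S1,S1),(False,S1,S1),(False,S1,S1)),
    [(False, 0, [], [Neg S2,Pos S1], ([Pos S1],[Pos S1],[Pos S2]))],
    ([Pos S1],[Pos S3],[Pos S3])),
  (((True,S3,S1),(True,S3,S1),(False,S1,S1)), ((True,S2,S1),(False,S1,S1),(False,S1,S1)),
    [(False, 0, [], [], ([Pos S1],[Pos S1],[Pos S2]))],
    ([Pos S1],[Pos S3],[Pos S3])),
  (((True,S3,S2),(True,S3,S1),(False,S1,S1)), ((True,S2,S1),(False,S1,S1),(False,S1,S1)),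
    [(False, 0, [], [], ([Pos S1],[Pos S1],[Pos S2]))],
    ([Pos S1],[Pos S3],[Pos S3])),
  (((True,S3,S1),(True,S3,S2),(False,S1,S1)), ((True,S2,S1),(False,S1,S1),(False,S1,S1)),
    [(False, 0, [], [], ([Pos S1],[Pos S1],[Pos S2]))],
    ([Pos S1],[Pos S3],[Pos S3])),
  (((True,S3,S2),(True,S3,S2),(False,S1,S1)), ((True,S2,S1),(False,S1,S1),(False,S1,S1)),
    [(False, 0, [], [], ([Pos S1],[Pos S1],[Pos S2]))],
    ([Pos S1],[Pos S3],[Pos S3])),
  (((True,S3,S1),(True,S3,S1),(False,S2,S1)), ((True,S2,S1),(False,S1,S1),(False,S1,S1)),
    [(False, 0, [], [], ([Pos S1],[Pos S1],[Pos S2]))],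
    ([Pos S1],[Pos S3],[Pos S3])),
  (((True,S3,S2),(True,S3,S1),(False,S2,S1)), ((True,S2,S1),(False,S1,S1),(False,S1,S1)),
    [(False, 0, [], [], ([Pos S1],[Pos S1],[Pos S2]))],
    ([Pos S1],[Pos S3],[Pos S3])),
  (((True,S3,S1),(True,S3,S2),(False,S2,S1)), ((True,S2,S1),(False,S1,S1),(False,S1,S1)),
    [(False, 0, [], [], ([Pos S1],[Pos S1],[Pos S2]))],
    ([Pos S1],[Pos S3],[Pos S3])),
  (((True,S2,S1),(False,S2,S2),(False,S2,S2)), ((True,S2,S1),(False,S1,S1),(False,S1,S1)),
    [(False, 1, [], [Pos S2], ([Pos S1],[],[])),
     (False, 0, [], [Neg S1], ([Neg S1],[],[]))],
    ([Pos S1],[Neg S1,Neg S1],[Neg S1,Neg S1])),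
  (((True,S3,S1),(False,S2,S2),(False,S2,S2)), ((True,S2,S1),(False,S1,S1),(False,S1,S1)),
    [(False, 1, [], [Pos S2], ([Pos S1],[],[])),
     (False, 0, [], [Neg S1], ([Neg S1],[],[]))],
    ([Pos S1],[Neg S1,Neg S1],[Neg S1,Neg S1])),
  (((True,S2,S1),(False,S3,S2),(False,S2,S2)), ((True,S2,S1),(False,S1,S1),(False,S1,S1)),
    [(False, 1, [], [Pos S2], ([Pos S1],[],[])),
     (False, 0, [], [Neg S1], ([Neg S1],[],[]))],
    ([Pos S1],[Neg S1,Neg S1],[Neg S1,Neg S1])),
  (((True,S3,S1),(False,S3,S2),(False,S2,S2)), ((True,S2,S1),(False,S1,S1),(False,S1,S1)),
    [(False, 1, [], [Pos S2], ([Pos S1],[],[])),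
     (False, 0, [], [Neg S1], ([Neg S1],[],[]))],
    ([Pos S1],[Neg S1,Neg S1],[Neg S1,Neg S1])),
  (((True,S2,S1),(False,S3,S3),(False,S2,S2)), ((True,S2,S1),(False,S1,S1),(False,S1,S1)),
    [(False, 1, [], [Pos S2], ([Pos S1],[],[])),
     (False, 0, [], [Neg S1], ([Neg S1],[],[]))],
    ([Pos S1],[Neg S1,Neg S1],[Neg S1,Neg S1])),
  (((True,S2,S1),(False,S2,S2),(False,S3,S2)), ((True,S2,S1),(False,S1,S1),(False,S1,S1)),
    [(False, 1, [], [Pos S2], ([Pos S1],[],[])),
     (False, 0, [], [Neg S1], ([Neg S1],[],[]))],
    ([Pos S1],[Neg S1,Neg S1],[Neg S1,Neg S1])),
  (((True,S3,S1),(False,S2,S2),(False,S3,S2)), ((True,S2,S1),(False,S1,S1),(False,S1,S1)),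
    [(False, 1, [], [Pos S2], ([Pos S1],[],[])),
     (False, 0, [], [Neg S1], ([Neg S1],[],[]))],
    ([Pos S1],[Neg S1,Neg S1],[Neg S1,Neg S1])),
  (((True,S2,S1),(False,S3,S2),(False,S3,S2)), ((True,S2,S1),(False,S1,S1),(False,S1,S1)),
    [(False, 1, [], [Pos S2], ([Pos S1],[],[])),
     (False, 0, [], [Neg S1], ([Neg S1],[],[]))],
    ([Pos S1],[Neg S1,Neg S1],[Neg S1,Neg S1])),
  (((True,S2,S1),(False,S2,S3),(False,S3,S2)), ((True,S2,S1),(False,S1,S1),(False,S1,S1)),
    [(False, 1, [], [Pos S2], ([Pos S1],[],[])),
     (False, 0, [], [Neg S1], ([Neg S1],[],[]))],
    ([Pos S1],[Neg S1,Neg S1],[Neg S1,Neg S1])),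
  (((True,S2,S1),(False,S2,S2),(False,S3,S3)), ((True,S2,S1),(False,S1,S1),(False,S1,S1)),
    [(False, 1, [], [Pos S2], ([Pos S1],[],[])),
     (False, 0, [], [Neg S1], ([Neg S1],[],[]))],
    ([Pos S1],[Neg S1,Neg S1],[Neg S1,Neg S1])),
  (((True,S3,S1),(True,S3,S1),(False,S3,S3)), ((True,S2,S1),(False,S1,S1),(False,S1,S1)),
    [(False, 1, [], [Pos S2], ([Pos S1],[Pos S1],[])),
     (False, 0, [], [Neg S1], ([Neg S1],[],[]))],
    ([Pos S1],[Neg S1,Neg S1],[Neg S1,Neg S1])),
  (((True,S3,S2),(True,S3,S1),(False,S3,S3)), ((True,S2,S1),(False,S1,S1),(False,S1,S1)),
    [(False, 1, [], [Pos S2], ([Pos S1],[Pos S1],[])),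
     (False, 0, [], [Neg S1], ([Neg S1],[Neg S1],[]))],
    ([Pos S1],[Neg S1,Neg S1],[Neg S1,Neg S1])),
  (((True,S3,S1),(True,S3,S2),(False,S3,S3)), ((True,S2,S1),(False,S1,S1),(False,S1,S1)),
    [(False, 1, [], [Pos S2], ([Pos S1],[Pos S1],[])),
     (False, 0, [], [Neg S1], ([Neg S1],[Neg S1],[]))],
    ([Pos S1],[Neg S1,Neg S1],[Neg S1,Neg S1])),
  (((True,S3,S3),(False,S2,S1),(False,S1,S1)), ((True,S1,S1),(False,S2,S1),(False,S1,S1)),
    [(False, 0, [], [Pos S3,Pos S1], ([Pos S1],[Neg S2],[Neg S3]))],
    ([Pos S1],[Pos S2],[Pos S3]))]"

definition conjugacies_2 :: "conjugacy list" where
  "conjugacies_2 = [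
  (((True,S2,S2),(False,S2,S1),(False,S1,S1)), ((True,S1,S1),(False,S2,S1),(False,S1,S1)),
    [(False, 0, [Pos S2], [Pos S2], ([Neg S2,Neg S1,Pos S2],[Neg S2],[Pos S3]))],
    ([Pos S2,Pos S1,Pos S2],[Pos S2],[Pos S3])),
  (((True,S3,S3),(True,S3,S2),(False,S1,S1)), ((True,S1,S1),(False,S2,S1),(False,S1,S1)),
    [(False, 0, [Pos S1,Pos S3], [Pos S1,Pos S3,Pos S3,Pos S1], ([Pos S1],[Neg S1,Neg S2,Neg S3],[Neg S3]))],
    ([Pos S1],[Pos S1,Pos S2,Pos S3],[Pos S3])),
  (((True,S1,S1),(True,S3,S1),(False,S3,S1)), ((True,S1,S1),(False,S2,S1),(False,S1,S1)),
    [(False, 0, [], [], ([Neg S1],[Pos S2,Pos S3,Pos S1],[Neg S2]))],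
    ([Pos S1],[Pos S3],[Pos S1,Neg S2,Pos S3])),
  (((True,S3,S3),(True,S3,S1),(False,S3,S1)), ((True,S1,S1),(True,S3,S1),(False,S3,S1)),
    [(False, 0, [Pos S3], [Neg S1], ([Neg S1],[Neg S2],[Pos S3]))],
    ([Pos S1],[Neg S2],[Pos S3])),
  (((True,S1,S1),(False,S3,S3),(False,S3,S1)), ((True,S1,S1),(True,S3,S1),(False,S3,S1)),
    [(False, 0, [], [], ([Pos S1],[Neg S2,Pos S1,Pos S3],[Pos S3]))],
    ([Neg S1],[Neg S1,Neg S3,Neg S2],[Neg S3])),
  (((True,S3,S3),(False,S3,S3),(False,S3,S1)), ((True,S1,S1),(False,S3,S3),(False,S3,S1)),
    [(False, 0, [Pos S3], [Pos S3], ([Neg S3,Pos S1,Pos S3],[Neg S2],[Neg S3]))],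
    ([Pos S3,Pos S1,Pos S3],[Pos S2],[Pos S3])),
  (((True,S3,S1),(True,S1,S1),(False,S3,S1)), ((True,S2,S1),(False,S2,S1),(False,S1,S1)),
    [(False, 0, [], [], ([Pos S1],[Neg S2,Pos S1,Pos S3],[Pos S2]))],
    ([Pos S1],[Pos S3],[Pos S1,Neg S2,Pos S3])),
  (((True,S3,S1),(True,S3,S3),(False,S3,S1)), ((True,S2,S1),(False,S2,S1),(False,S1,S1)),
    [(False, 0, [Neg S2], [Neg S1], ([Neg S1],[Pos S3,Neg S1,Neg S2],[Neg S2]))],
    ([Neg S1],[Neg S3],[Pos S2,Neg S3,Neg S1])),
  (((True,S3,S1),(False,S3,S3),(False,S3,S1)), ((True,S2,S1),(False,S2,S1),(False,S1,S1)),
    [(False, 0, [Neg S2], [Neg S1], ([Neg S1],[Pos S3,Neg S1,Neg S1],[Neg S2]))],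
    ([Neg S1],[Neg S3],[Pos S2,Neg S1,Neg S1])),
  (((True,S3,S1),(True,S2,S1),(False,S1,S1)), ((True,S3,S1),(False,S2,S1),(False,S1,S1)),
    [(False, 0, [], [Neg S1,Pos S3], ([Neg S1],[Pos S2,Pos S1],[Neg S3]))],
    ([Neg S1],[Pos S2,Pos S1],[Neg S3])),
  (((True,S3,S3),(False,S3,S1),(False,S1,S1)), ((True,S1,S1),(False,S3,S1),(False,S1,S1)),
    [(False, 0, [], [Pos S3,Pos S1], ([Pos S1],[Neg S2],[Neg S3]))],
    ([Pos S1],[Pos S2],[Pos S3])),
  (((True,S1,S1),(True,S3,S1),(False,S1,S1)), ((True,S1,S1),(False,S3,S1),(False,S1,S1)),
    [(True, 0, [], [], ([Neg S1],[Neg S1,Neg S2,Neg S3],[Neg S3]))],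
    ([Pos S1],[Pos S1,Pos S2,Pos S3],[Pos S3])),
  (((True,S3,S3),(True,S3,S1),(False,S1,S1)), ((True,S1,S1),(True,S3,S1),(False,S1,S1)),
    [(True, 0, [], [Neg S1,Neg S3], ([Pos S1],[Pos S2],[Neg S3]))],
    ([Pos S1],[Pos S2],[Pos S3])),
  (((True,S3,S1),(True,S1,S1),(False,S1,S1)), ((True,S3,S1),(False,S3,S1),(False,S1,S1)),
    [(False, 0, [], [Neg S1,Pos S3], ([Neg S1],[Pos S2,Pos S1],[Neg S3]))],
    ([Neg S1],[Pos S2,Pos S1],[Neg S3])),
  (((True,S3,S1),(True,S3,S3),(False,S1,S1)), ((True,S3,S1),(True,S1,S1),(False,S1,S1)),
    [(True, 0, [], [], ([Neg S1],[Pos S2,Pos S3],[Neg S3]))],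
    ([Neg S1],[Pos S2,Pos S3],[Neg S3])),
  (((True,S3,S3),(False,S2,S2),(False,S1,S1)), ((True,S1,S1),(False,S2,S2),(False,S1,S1)),
    [(False, 0, [], [Pos S3,Neg S1], ([Neg S1],[Neg S2],[Neg S3]))],
    ([Pos S1],[],[Pos S3])),
  (((True,S2,S2),(False,S2,S2),(False,S1,S1)), ((True,S1,S1),(False,S2,S2),(False,S1,S1)),
    [(False, 0, [], [Pos S1], ([Pos S1],[Pos S2],[Neg S3]))],
    ([Pos S1],[],[Pos S3])),
  (((True,S3,S3),(True,S2,S2),(False,S1,S1)), ((True,S1,S1),(False,S2,S2),(False,S1,S1)),
    [(False, 1, [], [Neg S3], ([Neg S1,Neg S3],[Neg S1,Neg S2],[Pos S3])),
     (False, 1, [], [Neg S3,Pos S1], ([Pos S1],[Pos S1,Pos S3],[Pos S3]))],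
    ([Pos S2],[],[Pos S3])),
  (((True,S2,S2),(True,S3,S3),(False,S1,S1)), ((True,S3,S3),(True,S2,S2),(False,S1,S1)),
    [(False, 0, [], [Pos S1], ([Pos S1],[Neg S2],[Neg S3]))],
    ([Pos S1],[Pos S2],[Pos S3])),
  (((True,S3,S3),(True,S1,S1),(False,S3,S3)), ((True,S3,S3),(True,S2,S2),(False,S1,S1)),
    [(False, 0, [], [Pos S3], ([Pos S1],[Pos S2],[]))],
    ([Neg S1,Neg S3],[Neg S2],[Pos S2,Pos S1])),
  (((True,S3,S3),(True,S2,S2),(False,S3,S3)), ((True,S3,S3),(True,S1,S1),(False,S3,S3)),
    [(False, 1, [], [], ([Neg S1],[Pos S2],[Neg S3])),
     (False, 1, [], [Neg S1], ([],[Pos S1],[]))],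
    ([Pos S1],[Pos S2],[])),
  (((True,S3,S1),(False,S2,S2),(False,S1,S1)), ((True,S2,S1),(False,S2,S2),(False,S1,S1)),
    [(False, 1, [], [Neg S3], ([Pos S1],[Pos S2],[Neg S3])),
     (False, 0, [], [Pos S1], ([Neg S1],[],[Pos S3]))],
    ([Pos S1],[],[Neg S3])),
  (((True,S2,S3),(True,S3,S1),(False,S3,S3)), ((True,S2,S1),(False,S2,S2),(False,S1,S1)),
    [(False, 1, [], [], ([Neg S1],[Pos S3,Neg S1],[Pos S2])),
     (False, 0, [], [Neg S1], ([Pos S1],[Neg S1],[]))],
    ([Neg S1],[],[Neg S1,Neg S1])),
  (((True,S3,S1),(False,S3,S3),(False,S1,S1)), ((True,S2,S1),(False,S2,S2),(False,S1,S1)),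
    [(False, 1, [], [Pos S1], ([Neg S1],[Neg S3,Neg S3,Neg S2],[Pos S3])),
     (False, 0, [], [Neg S3], ([Pos S1],[],[Neg S3]))],
    ([Neg S1],[],[Pos S3])),
  (((True,S1,S3),(True,S3,S2),(False,S3,S3)), ((True,S2,S3),(True,S3,S1),(False,S3,S3)),
    [(False, 1, [], [], ([Pos S1],[Pos S2],[Neg S3])),
     (False, 0, [], [Neg S1], ([Pos S2],[Pos S1],[]))],
    ([Pos S1],[Neg S1],[])),
  (((True,S3,S3),(False,S3,S2),(False,S1,S1)), ((True,S1,S1),(False,S3,S2),(False,S1,S1)),
    [(False, 0, [Pos S1,Pos S3], [Pos S1,Pos S3,Pos S3,Pos S1], ([Pos S1],[Neg S2],[Neg S3]))],
    ([Pos S1],[Pos S2],[Pos S3])),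
  (((True,S3,S3),(True,S2,S1),(False,S1,S1)), ((True,S1,S1),(False,S3,S2),(False,S1,S1)),
    [(False, 0, [Pos S1,Pos S3], [Pos S1,Pos S3,Pos S1,Pos S3], ([Pos S1],[Pos S3,Neg S1,Neg S2],[Pos S3]))],
    ([Pos S1],[Pos S1,Pos S3,Pos S2],[Pos S3])),
  (((True,S3,S3),(False,S3,S3),(False,S1,S1)), ((True,S1,S1),(False,S3,S3),(False,S1,S1)),
    [(False, 0, [], [Neg S3,Pos S1], ([Pos S1],[Pos S2],[Pos S3]))],
    ([Pos S1],[Pos S2],[Pos S3])),
  (((True,S2,S2),(False,S3,S3),(False,S1,S1)), ((True,S1,S1),(False,S3,S3),(False,S1,S1)),
    [(False, 0, [], [Pos S2,Pos S1], ([Pos S1],[Neg S2],[Neg S3]))],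
    ([Pos S1],[Pos S2],[Pos S3])),
  (((True,S1,S1),(False,S3,S1),(False,S2,S1)), ((True,S1,S1),(False,S2,S1),(False,S2,S1)),
    [(False, 0, [], [], ([Pos S1],[Pos S2],[Pos S2]))],
    ([Pos S1],[Pos S2],[Pos S2])),
  (((True,S1,S1),(False,S2,S1),(False,S3,S1)), ((True,S1,S1),(False,S2,S1),(False,S2,S1)),
    [(False, 0, [], [], ([Pos S1],[Pos S2],[Pos S2]))],
    ([Pos S1],[Pos S2],[Pos S2])),
  (((True,S1,S1),(True,S1,S1),(False,S3,S1)), ((True,S1,S1),(False,S2,S1),(False,S2,S1)),
    [(False, 0, [], [], ([Pos S1],[Pos S1],[Pos S2]))],
    ([Pos S1],[Pos S3],[Pos S3])),
  (((True,S2,S1),(True,S1,S1),(False,S3,S1)), ((True,S1,S1),(False,S2,S1),(False,S2,S1)),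
    [(False, 0, [], [], ([Pos S1],[Pos S1],[Pos S2]))],
    ([Pos S1],[Pos S3],[Pos S3])),
  (((True,S2,S2),(True,S1,S1),(False,S3,S1)), ((True,S1,S1),(False,S2,S1),(False,S2,S1)),
    [(False, 0, [], [], ([Pos S1],[Pos S1],[Pos S2]))],
    ([Pos S1],[Pos S3],[Pos S3])),
  (((True,S1,S1),(True,S2,S1),(False,S3,S1)), ((True,S1,S1),(False,S2,S1),(False,S2,S1)),
    [(False, 0, [], [], ([Pos S1],[Pos S1],[Pos S2]))],
    ([Pos S1],[Pos S3],[Pos S3])),
  (((True,S2,S1),(True,S2,S1),(False,S3,S1)), ((True,S1,S1),(False,S2,S1),(False,S2,S1)),
    [(False, 0, [], [], ([Pos S1],[Pos S1],[Pos S2]))],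
    ([Pos S1],[Pos S3],[Pos S3])),
  (((True,S1,S2),(True,S2,S1),(False,S3,S1)), ((True,S1,S1),(False,S2,S1),(False,S2,S1)),
    [(False, 0, [], [], ([Pos S1],[Pos S1],[Pos S2]))],
    ([Pos S1],[Pos S3],[Pos S3])),
  (((True,S2,S2),(True,S2,S1),(False,S3,S1)), ((True,S1,S1),(False,S2,S1),(False,S2,S1)),
    [(False, 0, [], [], ([Pos S1],[Pos S1],[Pos S2]))],
    ([Pos S1],[Pos S3],[Pos S3])),
  (((True,S1,S1),(True,S2,S2),(False,S3,S1)), ((True,S1,S1),(False,S2,S1),(False,S2,S1)),
    [(False, 0, [], [], ([Pos S1],[Pos S1],[Pos S2]))],
    ([Pos S1],[Pos S3],[Pos S3])),
  (((True,S2,S1),(True,S2,S2),(False,S3,S1)), ((True,S1,S1),(False,S2,S1),(False,S2,S1)),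
    [(False, 0, [], [], ([Pos S1],[Pos S1],[Pos S2]))],
    ([Pos S1],[Pos S3],[Pos S3])),
  (((True,S2,S2),(True,S2,S2),(False,S3,S1)), ((True,S1,S1),(False,S2,S1),(False,S2,S1)),
    [(False, 0, [], [], ([Pos S1],[Pos S1],[Pos S2]))],
    ([Pos S1],[Pos S3],[Pos S3])),
  (((True,S2,S2),(False,S2,S1),(False,S2,S1)), ((True,S1,S1),(False,S2,S1),(False,S2,S1)),
    [(False, 0, [Pos S2], [Pos S1], ([Pos S1],[Pos S2],[Pos S2]))],
    ([Pos S1],[Pos S2],[Pos S2]))]"

definition conjugacies_3 :: "conjugacy list" where
  "conjugacies_3 = [
  (((True,S3,S2),(False,S2,S1),(False,S2,S1)), ((True,S1,S1),(False,S2,S1),(False,S2,S1)),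
    [(False, 0, [Pos S2], [Pos S2,Pos S2,Neg S1], ([Pos S1],[Pos S2],[Pos S2]))],
    ([Pos S1],[Pos S2],[Pos S2])),
  (((True,S3,S3),(False,S2,S1),(False,S2,S1)), ((True,S1,S1),(False,S2,S1),(False,S2,S1)),
    [(False, 0, [Pos S2], [Pos S1], ([Pos S1],[Pos S2],[Pos S2]))],
    ([Pos S1],[Pos S2],[Pos S2])),
  (((True,S2,S2),(False,S3,S1),(False,S2,S1)), ((True,S1,S1),(False,S2,S1),(False,S2,S1)),
    [(False, 0, [Pos S2], [Pos S1], ([Pos S1],[Pos S2],[Pos S2]))],
    ([Pos S1],[Pos S2],[Pos S2])),
  (((True,S3,S2),(False,S3,S1),(False,S2,S1)), ((True,S1,S1),(False,S2,S1),(False,S2,S1)),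
    [(False, 0, [Pos S2], [Pos S1], ([Pos S1],[Pos S2],[Pos S2]))],
    ([Pos S1],[Pos S2],[Pos S2])),
  (((True,S2,S2),(False,S2,S1),(False,S3,S1)), ((True,S1,S1),(False,S2,S1),(False,S2,S1)),
    [(False, 0, [Pos S2], [Pos S1], ([Pos S1],[Pos S2],[Pos S2]))],
    ([Pos S1],[Pos S2],[Pos S2])),
  (((True,S3,S2),(False,S2,S1),(False,S3,S1)), ((True,S1,S1),(False,S2,S1),(False,S2,S1)),
    [(False, 0, [Pos S2], [Pos S1], ([Pos S1],[Pos S2],[Pos S2]))],
    ([Pos S1],[Pos S2],[Pos S2])),
  (((True,S3,S3),(True,S3,S3),(False,S3,S1)), ((True,S1,S1),(False,S2,S1),(False,S2,S1)),
    [(False, 0, [Pos S2], [Pos S1], ([Pos S1],[Pos S1],[Pos S2]))],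
    ([Pos S1],[Pos S3],[Pos S3])),
  (((True,S3,S1),(False,S2,S1),(False,S2,S1)), ((True,S2,S1),(False,S2,S1),(False,S2,S1)),
    [(False, 0, [], [], ([Pos S1],[Pos S2],[Pos S2]))],
    ([Pos S1],[Pos S2],[Pos S2])),
  (((True,S2,S1),(False,S3,S1),(False,S2,S1)), ((True,S2,S1),(False,S2,S1),(False,S2,S1)),
    [(False, 0, [], [], ([Pos S1],[Pos S2],[Pos S2]))],
    ([Pos S1],[Pos S2],[Pos S2])),
  (((True,S2,S1),(False,S2,S1),(False,S3,S1)), ((True,S2,S1),(False,S2,S1),(False,S2,S1)),
    [(False, 0, [], [], ([Pos S1],[Pos S2],[Pos S2]))],
    ([Pos S1],[Pos S2],[Pos S2])),
  (((True,S3,S1),(True,S3,S1),(False,S3,S1)), ((True,S2,S1),(False,S2,S1),(False,S2,S1)),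
    [(False, 0, [], [], ([Pos S1],[Pos S1],[Pos S2]))],
    ([Pos S1],[Pos S3],[Pos S3])),
  (((True,S3,S2),(True,S3,S1),(False,S3,S1)), ((True,S2,S1),(False,S2,S1),(False,S2,S1)),
    [(False, 0, [], [], ([Pos S1],[Pos S1],[Pos S2]))],
    ([Pos S1],[Pos S3],[Pos S3])),
  (((True,S3,S1),(True,S3,S2),(False,S3,S1)), ((True,S2,S1),(False,S2,S1),(False,S2,S1)),
    [(False, 0, [], [], ([Pos S1],[Pos S1],[Pos S2]))],
    ([Pos S1],[Pos S3],[Pos S3])),
  (((True,S3,S2),(True,S3,S2),(False,S3,S1)), ((True,S2,S1),(False,S2,S1),(False,S2,S1)),
    [(False, 0, [], [], ([Pos S1],[Pos S1],[Pos S2]))],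
    ([Pos S1],[Pos S3],[Pos S3])),
  (((True,S2,S2),(False,S1,S2),(False,S2,S1)), ((True,S1,S1),(False,S1,S2),(False,S2,S1)),
    [(False, 0, [Pos S2], [Pos S2], ([Neg S2,Neg S1,Neg S2],[Neg S2],[Neg S3]))],
    ([Pos S2,Pos S1,Pos S2],[Pos S2],[Pos S3])),
  (((True,S3,S1),(True,S2,S2),(False,S3,S1)), ((True,S2,S1),(False,S1,S2),(False,S2,S1)),
    [(False, 0, [Pos S1,Neg S2], [], ([Neg S1],[Pos S2,Neg S1],[Neg S3]))],
    ([Neg S1],[Pos S2,Neg S1],[Neg S3])),
  (((True,S1,S3),(True,S3,S1),(False,S3,S1)), ((True,S3,S1),(True,S2,S2),(False,S3,S1)),
    [(False, 0, [], [Neg S2], ([Pos S2,Neg S3],[Neg S1],[Neg S3]))],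
    ([Neg S2],[Pos S3,Neg S1],[Neg S3])),
  (((True,S3,S1),(False,S2,S2),(False,S3,S1)), ((True,S3,S1),(True,S2,S2),(False,S3,S1)),
    [(False, 0, [], [], ([Pos S1],[],[Pos S3]))],
    ([Pos S2,Pos S1],[Pos S1,Neg S3],[Pos S3])),
  (((True,S3,S3),(False,S2,S2),(False,S2,S1)), ((True,S1,S1),(False,S2,S2),(False,S2,S1)),
    [(False, 0, [Pos S3], [Pos S1], ([Pos S1],[Neg S2],[Pos S3]))],
    ([Pos S1],[],[Pos S3])),
  (((True,S2,S2),(False,S2,S2),(False,S2,S1)), ((True,S1,S1),(False,S2,S2),(False,S2,S1)),
    [(False, 0, [], [Pos S1], ([Pos S1],[Neg S2],[Pos S3]))],
    ([Pos S1],[],[Pos S3])),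
  (((True,S3,S3),(True,S3,S1),(False,S3,S3)), ((True,S1,S1),(False,S2,S2),(False,S2,S1)),
    [(False, 0, [], [Neg S1], ([Neg S1],[Pos S3,Pos S1],[Neg S2]))],
    ([Pos S1],[],[Pos S1,Neg S2])),
  (((True,S1,S1),(True,S3,S1),(False,S3,S3)), ((True,S3,S3),(True,S3,S1),(False,S3,S3)),
    [(False, 0, [], [Neg S1], ([Pos S1],[Neg S2],[]))],
    ([Pos S1],[Neg S2],[Neg S3])),
  (((True,S3,S1),(True,S1,S1),(False,S3,S3)), ((True,S2,S1),(False,S2,S2),(False,S2,S1)),
    [(True, 0, [], [Pos S1], ([Pos S1],[Pos S3,Pos S1],[Pos S2]))],
    ([Pos S1],[],[Pos S2,Neg S1])),
  (((True,S3,S3),(True,S3,S2),(False,S3,S3)), ((True,S2,S1),(False,S2,S2),(False,S2,S1)),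
    [(True, 0, [], [Pos S1], ([Pos S1,Neg S3],[Pos S1],[Neg S2]))],
    ([Pos S2],[],[Pos S1,Pos S2])),
  (((True,S2,S3),(True,S2,S1),(False,S3,S3)), ((True,S3,S1),(False,S2,S2),(False,S2,S1)),
    [(False, 0, [], [Neg S1], ([Pos S1],[Pos S3,Pos S1],[Pos S2]))],
    ([Pos S1],[],[Pos S2,Neg S1])),
  (((True,S3,S2),(False,S2,S2),(False,S3,S1)), ((True,S2,S3),(True,S2,S1),(False,S3,S3)),
    [(False, 0, [Pos S1], [], ([Pos S2],[],[Pos S1,Pos S2]))],
    ([Pos S3,Neg S1],[Pos S1],[Neg S2])),
  (((True,S3,S3),(False,S2,S3),(False,S2,S1)), ((True,S1,S1),(False,S2,S3),(False,S2,S1)),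
    [(False, 0, [Pos S2], [Pos S2,Pos S2,Pos S3], ([Neg S3,Neg S1,Pos S3],[Neg S2],[Neg S3]))],
    ([Pos S3,Pos S1,Pos S3],[Pos S2],[Pos S3])),
  (((True,S3,S3),(False,S3,S2),(False,S2,S1)), ((True,S1,S1),(False,S2,S3),(False,S2,S1)),
    [(False, 0, [Pos S1], [Pos S1,Pos S2,Pos S1], ([Neg S1,Neg S2,Neg S1,Neg S2,Neg S1],[Pos S1,Pos S2,Pos S1],[Pos S3]))],
    ([Pos S2,Pos S1,Pos S2],[Pos S2,Pos S1,Pos S2,Pos S1,Pos S2],[Pos S3])),
  (((True,S1,S1),(False,S1,S2),(False,S3,S1)), ((True,S1,S1),(False,S1,S3),(False,S2,S1)),
    [(True, 0, [Pos S1], [Pos S1], ([Pos S1],[Neg S3],[Pos S2]))],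
    ([Pos S1],[Pos S3],[Pos S2])),
  (((True,S3,S3),(True,S1,S1),(False,S3,S1)), ((True,S1,S1),(False,S1,S3),(False,S2,S1)),
    [(False, 0, [Pos S1,Pos S2], [Pos S1,Pos S2], ([Neg S1,Neg S2,Pos S3],[Neg S1],[Pos S3]))],
    ([Pos S2],[Pos S2,Pos S1,Pos S3],[Pos S3])),
  (((True,S3,S1),(True,S2,S2),(False,S1,S1)), ((True,S1,S1),(False,S1,S3),(False,S2,S1)),
    [(True, 0, [Pos S1,Pos S3], [Pos S1,Pos S3,Pos S3,Pos S2], ([Neg S3,Neg S1],[Pos S1],[Pos S2,Pos S3]))],
    ([Pos S2],[Neg S1,Pos S2],[Pos S1,Pos S2])),
  (((True,S3,S3),(True,S2,S2),(False,S3,S1)), ((True,S1,S1),(False,S1,S3),(False,S2,S1)),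
    [(False, 0, [Pos S1,Pos S2], [Pos S1,Pos S3], ([Pos S2,Pos S3,Pos S1],[Pos S1],[Pos S3]))],
    ([Pos S2],[Pos S1,Pos S2,Pos S3],[Pos S3])),
  (((True,S1,S1),(True,S3,S3),(False,S3,S1)), ((True,S3,S3),(True,S1,S1),(False,S3,S1)),
    [(False, 0, [Pos S3], [Pos S3], ([Neg S2],[Neg S1],[Pos S3]))],
    ([Pos S2],[Pos S1],[Pos S3])),
  (((True,S3,S1),(True,S2,S2),(False,S3,S3)), ((True,S3,S1),(True,S2,S2),(False,S1,S1)),
    [(True, 0, [Pos S1,Pos S2], [Pos S1,Pos S2,Neg S3], ([Neg S1],[Neg S2],[Neg S1,Neg S3,Neg S1]))],
    ([Neg S1],[Pos S2],[Pos S1,Pos S1])),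
  (((True,S1,S1),(False,S2,S2),(False,S3,S1)), ((True,S3,S1),(True,S2,S2),(False,S3,S3)),
    [(True, 0, [], [], ([Pos S2],[],[Pos S1,Pos S2]))],
    ([Pos S3,Pos S1],[Neg S1],[Neg S2])),
  (((True,S2,S2),(False,S2,S2),(False,S3,S1)), ((True,S1,S1),(False,S2,S2),(False,S3,S1)),
    [(False, 0, [], [Pos S1], ([Pos S1],[Neg S2],[Neg S3]))],
    ([Pos S1],[],[Pos S3])),
  (((True,S3,S3),(False,S2,S2),(False,S3,S1)), ((True,S1,S1),(False,S2,S2),(False,S3,S1)),
    [(False, 0, [Pos S3], [Pos S1], ([Pos S1],[Neg S2],[Pos S3]))],
    ([Pos S1],[],[Pos S3])),
  (((True,S3,S2),(False,S1,S2),(False,S3,S1)), ((True,S3,S2),(False,S1,S3),(False,S2,S1)),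
    [(True, 1, [], [], ([Neg S1],[Neg S3],[Neg S2])),
     (False, 0, [], [], ([Neg S1],[Neg S2],[Neg S3]))],
    ([Neg S1],[Neg S3],[Neg S2])),
  (((True,S1,S3),(True,S3,S2),(False,S3,S1)), ((True,S2,S1),(False,S1,S2),(False,S3,S1)),
    [(True, 0, [], [], ([Pos S1],[Pos S3,Neg S1,Pos S2],[Pos S2]))],
    ([Pos S1],[Pos S3],[Pos S2,Neg S1,Pos S3])),
  (((True,S1,S3),(True,S2,S1),(False,S3,S3)), ((True,S2,S1),(False,S2,S2),(False,S3,S1)),
    [(True, 0, [Neg S1], [], ([Neg S1],[Neg S1,Neg S3],[Pos S2]))],
    ([Neg S1],[],[Neg S2,Pos S1])),
  (((True,S3,S1),(True,S2,S1),(False,S3,S3)), ((True,S2,S1),(False,S2,S2),(False,S3,S1)),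
    [(False, 0, [], [], ([Pos S1],[Pos S3,Neg S1],[Pos S2]))],
    ([Pos S1],[],[Pos S2,Pos S1])),
  (((True,S1,S1),(True,S3,S2),(False,S3,S1)), ((True,S1,S1),(False,S3,S2),(False,S3,S1)),
    [(False, 0, [], [], ([Pos S1],[Pos S2,Pos S1,Neg S3],[Neg S3]))],
    ([Pos S1],[Pos S1,Pos S3,Neg S2],[Pos S3]))]"

definition conjugacies_4 :: "conjugacy list" where
  "conjugacies_4 = [
  (((True,S1,S1),(False,S2,S3),(False,S3,S1)), ((True,S1,S1),(True,S3,S2),(False,S3,S1)),
    [(False, 0, [], [], ([Pos S1],[Neg S2,Pos S1,Pos S3],[Pos S3]))],
    ([Pos S1],[Neg S1,Neg S3,Neg S2],[Neg S3])),
  (((True,S3,S1),(False,S2,S3),(False,S3,S1)), ((True,S3,S1),(False,S3,S2),(False,S3,S1)),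
    [(False, 0, [], [], ([Pos S1],[Neg S1,Pos S2,Pos S1],[Pos S3]))],
    ([Pos S1],[Pos S1,Pos S2,Neg S1],[Pos S3])),
  (((True,S1,S3),(True,S2,S1),(False,S3,S1)), ((True,S3,S1),(False,S3,S2),(False,S3,S1)),
    [(False, 0, [], [], ([Neg S1],[Neg S3,Neg S1,Pos S2],[Neg S3]))],
    ([Neg S1],[Neg S1,Neg S3,Pos S2],[Neg S3])),
  (((True,S3,S1),(True,S2,S1),(False,S3,S1)), ((True,S3,S1),(False,S3,S2),(False,S3,S1)),
    [(False, 0, [], [], ([Pos S1],[Pos S3,Neg S1,Pos S2],[Pos S3]))],
    ([Pos S1],[Pos S1,Neg S3,Pos S2],[Pos S3])),
  (((True,S3,S3),(False,S3,S2),(False,S3,S1)), ((True,S2,S2),(False,S3,S2),(False,S3,S1)),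
    [(False, 1, [], [Neg S3,Pos S2], ([Pos S1],[Pos S2],[Pos S3])),
     (False, 0, [Pos S3], [Pos S1], ([Neg S3,Pos S2,Pos S1,Neg S2,Pos S3],[Neg S3,Pos S2,Pos S3],[Pos S3]))],
    ([Pos S1],[Pos S2],[Pos S3])),
  (((True,S1,S1),(False,S3,S2),(False,S2,S2)), ((True,S1,S1),(False,S2,S2),(False,S2,S2)),
    [(False, 0, [], [], ([Pos S1],[],[]))],
    ([Pos S1],[],[])),
  (((True,S1,S1),(False,S3,S3),(False,S2,S2)), ((True,S1,S1),(False,S2,S2),(False,S2,S2)),
    [(False, 0, [], [], ([Pos S1],[],[]))],
    ([Pos S1],[],[])),
  (((True,S1,S1),(False,S2,S2),(False,S3,S2)), ((True,S1,S1),(False,S2,S2),(False,S2,S2)),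
    [(False, 0, [], [], ([Pos S1],[],[]))],
    ([Pos S1],[],[])),
  (((True,S1,S1),(False,S3,S2),(False,S3,S2)), ((True,S1,S1),(False,S2,S2),(False,S2,S2)),
    [(False, 0, [], [], ([Pos S1],[],[]))],
    ([Pos S1],[],[])),
  (((True,S1,S1),(False,S2,S3),(False,S3,S2)), ((True,S1,S1),(False,S2,S2),(False,S2,S2)),
    [(False, 0, [], [], ([Pos S1],[],[]))],
    ([Pos S1],[],[])),
  (((True,S1,S1),(False,S2,S2),(False,S3,S3)), ((True,S1,S1),(False,S2,S2),(False,S2,S2)),
    [(False, 0, [], [], ([Pos S1],[],[]))],
    ([Pos S1],[],[])),
  (((True,S1,S1),(True,S1,S1),(False,S3,S3)), ((True,S1,S1),(False,S2,S2),(False,S2,S2)),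
    [(False, 0, [], [], ([Pos S1],[Pos S1],[]))],
    ([Pos S1],[],[])),
  (((True,S2,S1),(True,S1,S1),(False,S3,S3)), ((True,S1,S1),(False,S2,S2),(False,S2,S2)),
    [(False, 0, [], [], ([Pos S1],[Pos S1],[]))],
    ([Pos S1],[],[])),
  (((True,S2,S2),(True,S1,S1),(False,S3,S3)), ((True,S1,S1),(False,S2,S2),(False,S2,S2)),
    [(False, 0, [], [], ([Pos S1],[Pos S1],[]))],
    ([Pos S1],[],[])),
  (((True,S1,S1),(True,S2,S1),(False,S3,S3)), ((True,S1,S1),(False,S2,S2),(False,S2,S2)),
    [(False, 0, [], [], ([Pos S1],[Pos S1],[]))],
    ([Pos S1],[],[])),
  (((True,S2,S1),(True,S2,S1),(False,S3,S3)), ((True,S1,S1),(False,S2,S2),(False,S2,S2)),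
    [(False, 0, [], [], ([Pos S1],[Pos S1],[]))],
    ([Pos S1],[],[])),
  (((True,S1,S2),(True,S2,S1),(False,S3,S3)), ((True,S1,S1),(False,S2,S2),(False,S2,S2)),
    [(False, 0, [], [], ([Pos S1],[Pos S1],[]))],
    ([Pos S1],[],[])),
  (((True,S1,S1),(True,S2,S2),(False,S3,S3)), ((True,S1,S1),(False,S2,S2),(False,S2,S2)),
    [(False, 0, [], [], ([Pos S1],[Pos S1],[]))],
    ([Pos S1],[],[])),
  (((True,S2,S2),(False,S2,S2),(False,S2,S2)), ((True,S1,S1),(False,S2,S2),(False,S2,S2)),
    [(False, 0, [], [Pos S1], ([Pos S1],[],[]))],
    ([Pos S1],[],[])),
  (((True,S3,S2),(False,S2,S2),(False,S2,S2)), ((True,S1,S1),(False,S2,S2),(False,S2,S2)),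
    [(False, 0, [], [Neg S1], ([Pos S1],[],[]))],
    ([Pos S1],[],[])),
  (((True,S3,S3),(False,S2,S2),(False,S2,S2)), ((True,S1,S1),(False,S2,S2),(False,S2,S2)),
    [(False, 0, [], [Pos S1], ([Pos S1],[],[]))],
    ([Pos S1],[],[])),
  (((True,S2,S2),(False,S3,S2),(False,S2,S2)), ((True,S1,S1),(False,S2,S2),(False,S2,S2)),
    [(False, 0, [], [Pos S1], ([Pos S1],[],[]))],
    ([Pos S1],[],[])),
  (((True,S3,S2),(False,S3,S2),(False,S2,S2)), ((True,S1,S1),(False,S2,S2),(False,S2,S2)),
    [(False, 0, [], [Pos S1], ([Pos S1],[],[]))],
    ([Pos S1],[],[])),
  (((True,S3,S3),(False,S3,S2),(False,S2,S2)), ((True,S1,S1),(False,S2,S2),(False,S2,S2)),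
    [(False, 0, [], [Pos S1], ([Pos S1],[],[]))],
    ([Pos S1],[],[])),
  (((True,S2,S2),(False,S3,S3),(False,S2,S2)), ((True,S1,S1),(False,S2,S2),(False,S2,S2)),
    [(False, 0, [], [Pos S1], ([Pos S1],[],[]))],
    ([Pos S1],[],[])),
  (((True,S3,S2),(False,S3,S3),(False,S2,S2)), ((True,S1,S1),(False,S2,S2),(False,S2,S2)),
    [(False, 0, [], [Pos S1], ([Pos S1],[],[]))],
    ([Pos S1],[],[])),
  (((True,S2,S2),(False,S2,S2),(False,S3,S2)), ((True,S1,S1),(False,S2,S2),(False,S2,S2)),
    [(False, 0, [], [Pos S1], ([Pos S1],[],[]))],
    ([Pos S1],[],[])),
  (((True,S3,S2),(False,S2,S2),(False,S3,S2)), ((True,S1,S1),(False,S2,S2),(False,S2,S2)),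
    [(False, 0, [], [Pos S1], ([Pos S1],[],[]))],
    ([Pos S1],[],[])),
  (((True,S3,S3),(False,S2,S2),(False,S3,S2)), ((True,S1,S1),(False,S2,S2),(False,S2,S2)),
    [(False, 0, [], [Pos S1], ([Pos S1],[],[]))],
    ([Pos S1],[],[])),
  (((True,S2,S2),(False,S3,S2),(False,S3,S2)), ((True,S1,S1),(False,S2,S2),(False,S2,S2)),
    [(False, 0, [], [Pos S1], ([Pos S1],[],[]))],
    ([Pos S1],[],[])),
  (((True,S3,S2),(False,S3,S2),(False,S3,S2)), ((True,S1,S1),(False,S2,S2),(False,S2,S2)),
    [(False, 0, [], [Pos S1], ([Pos S1],[],[]))],
    ([Pos S1],[],[])),
  (((True,S2,S2),(False,S2,S3),(False,S3,S2)), ((True,S1,S1),(False,S2,S2),(False,S2,S2)),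
    [(False, 0, [], [Pos S1], ([Pos S1],[],[]))],
    ([Pos S1],[],[])),
  (((True,S3,S2),(False,S2,S3),(False,S3,S2)), ((True,S1,S1),(False,S2,S2),(False,S2,S2)),
    [(False, 0, [], [Pos S1], ([Pos S1],[],[]))],
    ([Pos S1],[],[])),
  (((True,S2,S2),(False,S2,S2),(False,S3,S3)), ((True,S1,S1),(False,S2,S2),(False,S2,S2)),
    [(False, 0, [], [Pos S1], ([Pos S1],[],[]))],
    ([Pos S1],[],[])),
  (((True,S3,S2),(False,S2,S2),(False,S3,S3)), ((True,S1,S1),(False,S2,S2),(False,S2,S2)),
    [(False, 0, [], [Pos S1], ([Pos S1],[],[]))],
    ([Pos S1],[],[])),
  (((True,S3,S3),(True,S3,S3),(False,S3,S3)), ((True,S1,S1),(False,S2,S2),(False,S2,S2)),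
    [(False, 0, [], [Pos S1], ([Pos S1],[Pos S1],[]))],
    ([Pos S1],[],[])),
  (((True,S1,S1),(True,S1,S1),(True,S1,S1)), ((True,S1,S1),(False,S2,S2),(False,S2,S2)),
    [(False, 0, [], [], ([Pos S1],[Pos S1],[Pos S1]))],
    ([Pos S1],[],[])),
  (((True,S1,S1),(True,S3,S3),(False,S1,S1)), ((True,S3,S3),(True,S1,S1),(False,S1,S1)),
    [(False, 0, [], [Neg S1,Pos S3], ([Pos S1],[Pos S2],[Pos S3]))],
    ([Pos S1],[Pos S2],[Pos S3])),
  (((True,S3,S3),(True,S1,S1),(False,S2,S1)), ((True,S3,S3),(True,S2,S2),(False,S2,S1)),
    [(False, 1, [], [], ([Neg S1],[Neg S3,Neg S2,Neg S3],[Pos S3])),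
     (True, 2, [], [], ([Pos S1],[Pos S2],[Neg S3])),
     (True, 3, [], [Neg S3,Pos S2], ([Pos S2],[Neg S1],[Pos S3])),
     (False, 0, [Pos S3], [Pos S1], ([Neg S3,Neg S2,Pos S3],[Pos S1],[Pos S3]))],
    ([Pos S1],[Pos S3,Pos S2,Pos S3],[Pos S3])),
  (((True,S3,S3),(True,S3,S2),(False,S3,S1)), ((True,S1,S1),(True,S3,S1),(False,S2,S1)),
    [(True, 0, [Neg S2,Pos S3], [], ([Pos S1],[Pos S2],[Neg S1,Neg S3,Pos S2]))],
    ([Pos S1],[Pos S2],[Pos S2,Pos S3,Pos S1])),
  (((True,S1,S3),(True,S3,S2),(False,S2,S1)), ((True,S2,S3),(True,S3,S1),(False,S2,S1)),
    [(True, 1, [], [], ([Neg S1],[Neg S2],[Neg S3])),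
     (False, 0, [], [], ([Neg S2],[Neg S1],[Neg S3]))],
    ([Neg S1],[Neg S2],[Neg S3]))]"

text \<open>Arranged by the number of active states: the trivial group comes first, then 69 automata
  with one active state and 53 with two. Automata with three active states give the group of order
  two, which is also the group of \<open>((True,S1,S1),(False,S2,S2),(False,S2,S2))\<close>.\<close>

definition representatives :: "rows list" where
  "representatives = [
  ((False,S1,S1),(False,S1,S1),(False,S1,S1)),
  ((True,S1,S1),(False,S1,S1),(False,S1,S1)),
  ((True,S2,S1),(False,S1,S1),(False,S1,S1)),
  ((True,S1,S1),(False,S2,S1),(False,S1,S1)),
  ((True,S2,S1),(False,S2,S1),(False,S1,S1)),
  ((True,S3,S1),(False,S2,S1),(False,S1,S1)),
  ((True,S3,S2),(False,S2,S1),(False,S1,S1)),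
  ((True,S1,S1),(False,S3,S1),(False,S1,S1)),
  ((True,S2,S1),(False,S3,S1),(False,S1,S1)),
  ((True,S3,S1),(False,S3,S1),(False,S1,S1)),
  ((True,S2,S2),(False,S3,S1),(False,S1,S1)),
  ((True,S3,S2),(False,S3,S1),(False,S1,S1)),
  ((True,S1,S1),(False,S2,S2),(False,S1,S1)),
  ((True,S2,S1),(False,S2,S2),(False,S1,S1)),
  ((True,S3,S2),(False,S2,S2),(False,S1,S1)),
  ((True,S1,S1),(False,S3,S2),(False,S1,S1)),
  ((True,S2,S1),(False,S3,S2),(False,S1,S1)),
  ((True,S3,S1),(False,S3,S2),(False,S1,S1)),
  ((True,S2,S2),(False,S3,S2),(False,S1,S1)),
  ((True,S3,S2),(False,S3,S2),(False,S1,S1)),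
  ((True,S1,S1),(False,S3,S3),(False,S1,S1)),
  ((True,S2,S1),(False,S3,S3),(False,S1,S1)),
  ((True,S3,S2),(False,S3,S3),(False,S1,S1)),
  ((True,S1,S1),(False,S2,S1),(False,S2,S1)),
  ((True,S2,S1),(False,S2,S1),(False,S2,S1)),
  ((True,S1,S1),(False,S1,S2),(False,S2,S1)),
  ((True,S2,S1),(False,S1,S2),(False,S2,S1)),
  ((True,S3,S1),(False,S1,S2),(False,S2,S1)),
  ((True,S3,S2),(False,S1,S2),(False,S2,S1)),
  ((True,S3,S3),(False,S1,S2),(False,S2,S1)),
  ((True,S1,S1),(False,S2,S2),(False,S2,S1)),
  ((True,S2,S1),(False,S2,S2),(False,S2,S1)),
  ((True,S3,S1),(False,S2,S2),(False,S2,S1)),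
  ((True,S3,S2),(False,S2,S2),(False,S2,S1)),
  ((True,S1,S1),(False,S3,S2),(False,S2,S1)),
  ((True,S2,S1),(False,S3,S2),(False,S2,S1)),
  ((True,S3,S1),(False,S3,S2),(False,S2,S1)),
  ((True,S2,S2),(False,S3,S2),(False,S2,S1)),
  ((True,S3,S2),(False,S3,S2),(False,S2,S1)),
  ((True,S1,S1),(False,S2,S3),(False,S2,S1)),
  ((True,S1,S1),(False,S1,S3),(False,S2,S1)),
  ((True,S2,S1),(False,S1,S3),(False,S2,S1)),
  ((True,S2,S2),(False,S1,S3),(False,S2,S1)),
  ((True,S3,S2),(False,S1,S3),(False,S2,S1)),
  ((True,S2,S1),(False,S2,S3),(False,S2,S1)),
  ((True,S3,S1),(False,S2,S3),(False,S2,S1)),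
  ((True,S2,S2),(False,S2,S3),(False,S2,S1)),
  ((True,S3,S2),(False,S2,S3),(False,S2,S1)),
  ((True,S1,S1),(False,S3,S3),(False,S2,S1)),
  ((True,S2,S1),(False,S3,S3),(False,S2,S1)),
  ((True,S3,S1),(False,S3,S3),(False,S2,S1)),
  ((True,S2,S2),(False,S3,S3),(False,S2,S1)),
  ((True,S3,S2),(False,S3,S3),(False,S2,S1)),
  ((True,S3,S3),(False,S3,S3),(False,S2,S1)),
  ((True,S2,S1),(False,S1,S2),(False,S3,S1)),
  ((True,S2,S2),(False,S1,S2),(False,S3,S1)),
  ((True,S2,S1),(False,S2,S2),(False,S3,S1)),
  ((True,S1,S1),(False,S3,S2),(False,S3,S1)),
  ((True,S2,S1),(False,S3,S2),(False,S3,S1)),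
  ((True,S3,S1),(False,S3,S2),(False,S3,S1)),
  ((True,S2,S2),(False,S3,S2),(False,S3,S1)),
  ((True,S3,S2),(False,S3,S2),(False,S3,S1)),
  ((True,S2,S1),(False,S2,S3),(False,S3,S1)),
  ((True,S2,S2),(False,S2,S3),(False,S3,S1)),
  ((True,S3,S2),(False,S2,S3),(False,S3,S1)),
  ((True,S3,S3),(False,S2,S3),(False,S3,S1)),
  ((True,S2,S1),(False,S3,S3),(False,S3,S1)),
  ((True,S2,S2),(False,S3,S3),(False,S3,S1)),
  ((True,S3,S2),(False,S3,S3),(False,S3,S1)),
  ((True,S1,S1),(False,S2,S2),(False,S2,S2)),
  ((True,S3,S2),(True,S1,S1),(False,S1,S1)),
  ((True,S3,S3),(True,S1,S1),(False,S1,S1)),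
  ((True,S3,S2),(True,S2,S1),(False,S1,S1)),
  ((True,S1,S3),(True,S2,S1),(False,S1,S1)),
  ((True,S2,S3),(True,S2,S1),(False,S1,S1)),
  ((True,S2,S1),(True,S3,S1),(False,S1,S1)),
  ((True,S1,S2),(True,S3,S1),(False,S1,S1)),
  ((True,S2,S2),(True,S3,S1),(False,S1,S1)),
  ((True,S1,S3),(True,S3,S1),(False,S1,S1)),
  ((True,S2,S3),(True,S3,S1),(False,S1,S1)),
  ((True,S3,S2),(True,S2,S2),(False,S1,S1)),
  ((True,S1,S1),(True,S3,S2),(False,S1,S1)),
  ((True,S2,S1),(True,S3,S2),(False,S1,S1)),
  ((True,S1,S2),(True,S3,S2),(False,S1,S1)),
  ((True,S2,S2),(True,S3,S2),(False,S1,S1)),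
  ((True,S1,S3),(True,S3,S2),(False,S1,S1)),
  ((True,S2,S3),(True,S3,S2),(False,S1,S1)),
  ((True,S2,S1),(True,S3,S3),(False,S1,S1)),
  ((True,S3,S2),(True,S3,S3),(False,S1,S1)),
  ((True,S3,S1),(True,S1,S1),(False,S2,S1)),
  ((True,S3,S2),(True,S1,S1),(False,S2,S1)),
  ((True,S3,S3),(True,S2,S2),(False,S2,S1)),
  ((True,S3,S1),(True,S2,S1),(False,S2,S1)),
  ((True,S3,S2),(True,S2,S1),(False,S2,S1)),
  ((True,S1,S3),(True,S2,S1),(False,S2,S1)),
  ((True,S2,S3),(True,S2,S1),(False,S2,S1)),
  ((True,S3,S3),(True,S2,S1),(False,S2,S1)),
  ((True,S1,S1),(True,S3,S1),(False,S2,S1)),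
  ((True,S1,S3),(True,S3,S1),(False,S2,S1)),
  ((True,S2,S3),(True,S3,S1),(False,S2,S1)),
  ((True,S3,S3),(True,S3,S1),(False,S2,S1)),
  ((True,S3,S1),(True,S2,S2),(False,S2,S1)),
  ((True,S3,S3),(True,S3,S2),(False,S2,S1)),
  ((True,S3,S2),(True,S1,S1),(False,S3,S1)),
  ((True,S3,S2),(True,S2,S1),(False,S3,S1)),
  ((True,S2,S3),(True,S2,S1),(False,S3,S1)),
  ((True,S3,S3),(True,S2,S1),(False,S3,S1)),
  ((True,S2,S1),(True,S3,S1),(False,S3,S1)),
  ((True,S1,S2),(True,S3,S1),(False,S3,S1)),
  ((True,S2,S2),(True,S3,S1),(False,S3,S1)),
  ((True,S2,S3),(True,S3,S1),(False,S3,S1)),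
  ((True,S3,S2),(True,S2,S2),(False,S3,S1)),
  ((True,S2,S1),(True,S3,S2),(False,S3,S1)),
  ((True,S1,S2),(True,S3,S2),(False,S3,S1)),
  ((True,S2,S2),(True,S3,S2),(False,S3,S1)),
  ((True,S2,S3),(True,S3,S2),(False,S3,S1)),
  ((True,S2,S1),(True,S3,S3),(False,S3,S1)),
  ((True,S2,S2),(True,S3,S3),(False,S3,S1)),
  ((True,S3,S2),(True,S3,S3),(False,S3,S1)),
  ((True,S3,S2),(True,S1,S1),(False,S3,S3)),
  ((True,S3,S2),(True,S2,S1),(False,S3,S3)),
  ((True,S3,S3),(True,S2,S1),(False,S3,S3)),
  ((True,S1,S3),(True,S3,S1),(False,S3,S3))]"


text \<open>\<open>code_simp\<close> evaluates the checks by rewriting with code equations inside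
  the logic, so no compiled code is trusted.\<close>

lemma check_conjugacies_1: "list_all check_conjugacy conjugacies_1"
  by code_simp

lemma check_conjugacies_2: "list_all check_conjugacy conjugacies_2"
  by code_simp

lemma check_conjugacies_3: "list_all check_conjugacy conjugacies_3"
  by code_simp

lemma check_conjugacies_4: "list_all check_conjugacy conjugacies_4"
  by code_simp

section \<open>Every automaton group is represented\<close>

definition represented :: "rows \<Rightarrow> bool" where
  "represented a \<longleftrightarrow> (\<exists>r\<in>set representatives. isomorphic (on_state a) (on_state r))"

text \<open>An equation rather than an implication, so that simplification can replace one automaton
  by another.\<close>

lemma represented_cong: "isomorphic (on_state a) (on_state b) \<Longrightarrow> represented a = represented b"
  unfolding represented_def by (meson isomorphic_sym isomorphic_trans)

lemma represented_conjugacies: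
  assumes "list_all check_conjugacy cs"
  shows "list_all (\<lambda>(a, b, _). represented a = represented b) cs"
  using assms by (auto simp: list_all_iff intro!: represented_cong check_conjugacy_sound)

\<comment> \<open>As rewrite rules these equations lead from any automaton of the table to its representative.\<close>
lemmas represented_reduce =
  represented_conjugacies[OF check_conjugacies_1,
    unfolded conjugacies_1_def list.pred_inject prod.case simp_thms]
  represented_conjugacies[OF check_conjugacies_2,
    unfolded conjugacies_2_def list.pred_inject prod.case simp_thms]
  represented_conjugacies[OF check_conjugacies_3,
    unfolded conjugacies_3_def list.pred_inject prod.case simp_thms]
  represented_conjugacies[OF check_conjugacies_4,
    unfolded conjugacies_4_def list.pred_inject prod.case simp_thms]

lemma represented_representatives: "list_all represented representatives"
  unfolding list_all_iff represented_def using isomorphic_refl by blast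

lemmas represented_base =
  represented_representatives[unfolded representatives_def list.pred_inject simp_thms]

section \<open>The symmetries as rewrite rules\<close>

lemma represented_mirror:
  "represented (mirror t (on_state a) S1, mirror t (on_state a) S2, mirror t (on_state a) S3) =
   represented a"
proof (rule represented_cong)
  have "on_state (mirror t (on_state a) S1, mirror t (on_state a) S2, mirror t (on_state a) S3) =
      mirror t (on_state a)"
    by (rule ext) (simp add: on_state_def split: state.split)
  then show "isomorphic
      (on_state (mirror t (on_state a) S1, mirror t (on_state a) S2, mirror t (on_state a) S3))
      (on_state a)"
    using isomorphic_mirror isomorphic_sym by metis
qed

lemma represented_exchange:
  fixes A :: automaton and p :: "state \<times> state"
  defines "B \<equiv> rename (exchange p) A"
  shows "represented (B S1, B S2, B S3) = represented (A S1, A S2, A S3)"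
proof (rule represented_cong)
  have row: "on_state (A S1, A S2, A S3) = A" for A :: automaton
    by (rule ext) (simp add: on_state_def split: state.split)
  have "exchange p (exchange p q) = q" for q by (cases p) auto
  then show "isomorphic (on_state (B S1, B S2, B S3)) (on_state (A S1, A S2, A S3))"
    unfolding row B_def by (intro isomorphic_sym[OF isomorphic_rename])
qed

lemma represented_mirror_active_1:
  "represented ((True, l, r), (False, y), (False, z)) =
   represented ((True, r, l), (False, y), (False, z))"
  using represented_mirror[of True "((True, l, r), (False, y), (False, z))"]
  by (cases y; cases z) (simp add: mirror_def on_state_def)

text \<open>Both inactive rows are reversed together, so only one of them can be sorted: the last
  one, or the one before it if the last is constant. The same happens to the two active rows in
  \<open>represented_mirror_active_2\<close>.\<close>

lemma represented_mirror_inactive_1: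
  "represented ((True, x), (False, l, r), (False, l', r')) =
   represented ((True, x), (False, r, l), (False, r', l'))"
  using represented_mirror[of False "((True, x), (False, l, r), (False, l', r'))"]
  by (cases x) (simp add: mirror_def on_state_def)

lemma represented_mirror_active_2:
  "represented ((True, l, r), (True, l', r'), (False, z)) =
   represented ((True, r, l), (True, r', l'), (False, z))"
  using represented_mirror[of True "((True, l, r), (True, l', r'), (False, z))"]
  by (cases z) (simp add: mirror_def on_state_def)

lemma represented_mirror_inactive_2:
  "represented ((True, x), (True, y), (False, l, r)) =
   represented ((True, x), (True, y), (False, r, l))"
  using represented_mirror[of False "((True, x), (True, y), (False, l, r))"]
  by (cases x; cases y) (simp add: mirror_def on_state_def)

\<comment> \<open>Ground instances, oriented such that simplification sorts the rows.\<close>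
lemmas represented_sort_1 =
  represented_mirror_active_1[of S1 S2] represented_mirror_active_1[of S1 S3]
  represented_mirror_active_1[of S2 S3]
  represented_mirror_inactive_1[where l' = S1 and r' = S2]
  represented_mirror_inactive_1[where l' = S1 and r' = S3]
  represented_mirror_inactive_1[where l' = S2 and r' = S3]
  represented_mirror_inactive_1[where l = S1 and r = S2 and l' = p and r' = p for p]
  represented_mirror_inactive_1[where l = S1 and r = S3 and l' = p and r' = p for p]
  represented_mirror_inactive_1[where l = S2 and r = S3 and l' = p and r' = p for p]

lemmas represented_sort_2 =
  represented_mirror_inactive_2[where l = S1 and r = S2]
  represented_mirror_inactive_2[where l = S1 and r = S3]
  represented_mirror_inactive_2[where l = S2 and r = S3]
  represented_mirror_active_2[where l' = S1 and r' = S2]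
  represented_mirror_active_2[where l' = S1 and r' = S3]
  represented_mirror_active_2[where l' = S2 and r' = S3]
  represented_mirror_active_2[where l = S1 and r = S2 and l' = p and r' = p for p]
  represented_mirror_active_2[where l = S1 and r = S3 and l' = p and r' = p for p]
  represented_mirror_active_2[where l = S2 and r = S3 and l' = p and r' = p for p]

section \<open>Case distinction by the number of active states\<close>

abbreviation swap_states :: "state \<times> state \<Rightarrow> state \<times> state \<Rightarrow> state \<times> state" where
  "swap_states p \<equiv> map_prod (exchange p) (exchange p)"

text \<open>Exchanging the two inactive states appears as a second disjunct because as a rewrite
  rule it would undo itself. In each of the 729 cases sorting and the table lead at least one of the
  two automata to a representative.\<close>

lemma represented_one_active_or_swapped:
  "represented ((True, l1, r1), (False, l2, r2), (False, l3, r3)) \<or>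
   represented ((True, swap_states (S2, S3) (l1, r1)), (False, swap_states (S2, S3) (l3, r3)),
     (False, swap_states (S2, S3) (l2, r2)))"
  by (cases l1; cases r1; cases l2; cases r2; cases l3; cases r3)
    (simp_all only: represented_sort_1 represented_reduce represented_base map_prod_simp
      exchange.simps state.distinct simp_thms if_True if_False)

lemma represented_two_active_or_swapped:
  "represented ((True, l1, r1), (True, l2, r2), (False, l3, r3)) \<or>
   represented ((True, swap_states (S1, S2) (l2, r2)), (True, swap_states (S1, S2) (l1, r1)),
     (False, swap_states (S1, S2) (l3, r3)))"
  by (cases l1; cases r1; cases l2; cases r2; cases l3; cases r3)
    (simp_all only: represented_sort_2 represented_reduce represented_base map_prod_simp
      exchange.simps state.distinct simp_thms if_True if_False)

lemma represented_one_active: "represented ((True, x), (False, y), (False, z))"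
proof -
  obtain l1 r1 l2 r2 l3 r3 where xyz: "x = (l1, r1)" "y = (l2, r2)" "z = (l3, r3)"
    by (metis surj_pair)
  show ?thesis
    using represented_one_active_or_swapped[of l1 r1 l2 r2 l3 r3]
      represented_exchange[of "(S2, S3)"
        "on_state ((True, l1, r1), (False, l2, r2), (False, l3, r3))"]
    by (simp add: xyz rename_def on_state_def)
qed

lemma represented_two_active: "represented ((True, x), (True, y), (False, z))"
proof -
  obtain l1 r1 l2 r2 l3 r3 where xyz: "x = (l1, r1)" "y = (l2, r2)" "z = (l3, r3)"
    by (metis surj_pair)
  show ?thesis
    using represented_two_active_or_swapped[of l1 r1 l2 r2 l3 r3]
      represented_exchange[of "(S1, S2)"
        "on_state ((True, l1, r1), (True, l2, r2), (False, l3, r3))"]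
    by (simp add: xyz rename_def on_state_def)
qed

lemma state_map_all_inactive:
  assumes "\<And>q. \<not> fst (A q)"
  shows "state_map A q u = u"
proof (induction u arbitrary: q)
  case (Cons x u)
  then show ?case using assms[of q] by (auto split: prod.splits)
qed simp

lemma state_map_all_active:
  assumes "\<And>q. fst (A q)"
  shows "state_map A q u = map Not u"
proof (induction u arbitrary: q)
  case (Cons x u)
  then show ?case using assms[of q] by (auto split: prod.splits)
qed simp

lemma isomorphic_state_map_cong:
  assumes "\<And>q u. state_map A q u = state_map B q u"
  shows "isomorphic A B"
proof -
  have "state_map A = state_map B" using assms by (intro ext)
  then show ?thesis by (simp add: isomorphic_def automaton_group_def iso_refl)
qed

lemma represented_all_inactive: "represented ((False, x), (False, y), (False, z))"
proof -
  have "isomorphic (on_state ((False, x), (False, y), (False, z)))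
      (on_state ((False, S1, S1), (False, S1, S1), (False, S1, S1)))"
    by (intro isomorphic_state_map_cong, subst (1 2) state_map_all_inactive)
      (auto simp: on_state_def split: state.split)
  from represented_cong[OF this] show ?thesis by (simp only: represented_base)
qed

text \<open>If all states are active, each of them flips every letter whatever its sections are. One
  automaton, which is an entry of the table, therefore stands for all of them.\<close>

lemma represented_all_active: "represented ((True, x), (True, y), (True, z))"
proof -
  have "isomorphic (on_state ((True, x), (True, y), (True, z)))
      (on_state ((True, S1, S1), (True, S1, S1), (True, S1, S1)))"
    by (intro isomorphic_state_map_cong, subst (1 2) state_map_all_active)
      (auto simp: on_state_def split: state.split)
  from represented_cong[OF this] show ?thesis
    by (simp only: represented_reduce represented_base)
qed

lemma represented_rows: "represented (A S1, A S2, A S3)"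
proof -
  have sw: "represented (A S1, A S2, A S3)"
    if "represented (rename (exchange p) A S1, rename (exchange p) A S2, rename (exchange p) A S3)"
    for p using that represented_exchange by blast
  obtain a x b y c z where A: "A S1 = (a, x)" "A S2 = (b, y)" "A S3 = (c, z)"
    by (metis surj_pair)
  \<comment> \<open>At most one transposition brings the active states to the front: a single active
    state is exchanged with \<open>S1\<close>, a single inactive one with \<open>S3\<close>.\<close>
  show ?thesis
    using sw[of "(S1, S2)"] sw[of "(S1, S3)"] sw[of "(S2, S3)"]
    by (cases a; cases b; cases c; cases x; cases y; cases z)
      (simp_all add: A rename_def represented_all_inactive represented_all_active
        represented_one_active represented_two_active)
qed

section \<open>Counting isomorphism classes\<close>

lemma automaton_group_representative:
  "\<exists>r\<in>set representatives. automaton_group A \<cong> automaton_group (on_state r)"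
proof -
  have "on_state (A S1, A S2, A S3) = A"
    by (rule ext) (simp add: on_state_def split: state.split)
  then show ?thesis using represented_rows[of A] by (simp add: represented_def isomorphic_def)
qed

theorem theorem1:
  shows "(\<forall>\<G> :: 'a monoid set.
            (\<forall>G\<in>\<G>. complexity_3_2 G) \<and> pairwise (\<lambda>G H. \<not> G \<cong> H) \<G>
              \<longrightarrow> finite \<G> \<and> card \<G> \<le> 124) \<and>
         finite (iso_classes (range automaton_group)) \<and>
         card (iso_classes (range automaton_group)) \<le> 124"
proof -
  let ?R = "set representatives"
  \<comment> \<open>There are 123 entries, one fewer than the bound.\<close>
  have "length representatives \<le> 124" by (simp add: representatives_def)
  then have R: "finite ?R" "card ?R \<le> 124" using card_length[of representatives] by auto
  have "finite \<G> \<and> card \<G> \<le> 124"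
    if \<G>: "\<And>G. G \<in> \<G> \<Longrightarrow> complexity_3_2 G" "pairwise (\<lambda>G H. \<not> G \<cong> H) \<G>"
    for \<G> :: "'a monoid set"
  proof -
    have "\<exists>r\<in>?R. G \<cong> automaton_group (on_state r)" if "G \<in> \<G>" for G
      using \<G>(1)[OF that] automaton_group_representative iso_trans
      unfolding complexity_3_2_def by blast
    then obtain f where f: "\<And>G. G \<in> \<G> \<Longrightarrow> f G \<in> ?R \<and> G \<cong> automaton_group (on_state (f G))"
      by metis
    \<comment> \<open>Two members with the same representative are isomorphic through it, which
      pairwise non-isomorphism excludes unless they are equal.\<close>
    have "inj_on f \<G>"
    proof (rule inj_onI)
      fix G H assume GH: "G \<in> \<G>" "H \<in> \<G>" "f G = f H"
      have "group H" using \<G>(1) GH by (auto simp: complexity_3_2_def)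
      then have "automaton_group (on_state (f H)) \<cong> H" using f GH group.iso_sym by blast
      then have "G \<cong> H" using f[of G] GH iso_trans by metis
      then show "G = H" using \<G>(2) GH by (auto simp: pairwise_def)
    qed
    moreover have "f ` \<G> \<subseteq> ?R" using f by blast
    ultimately show ?thesis
      using R by (meson card_inj_on_le finite_subset inj_on_finite le_trans)
  qed
  moreover have "finite (iso_classes (range automaton_group)) \<and>
    card (iso_classes (range automaton_group)) \<le> 124"
  proof -
    define rel where "rel = {(G, H). G \<in> range automaton_group \<and> H \<in> range automaton_group \<and> G \<cong> H}"
    \<comment> \<open>The classes of the representatives; they exhaust the quotient, because
      isomorphic groups have the same class.\<close>
    let ?c = "\<lambda>r. rel `` {automaton_group (on_state r)}"
    have "rel `` {automaton_group A} \<in> ?c ` ?R" for A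
    proof -
      obtain r where r: "r \<in> ?R" "automaton_group A \<cong> automaton_group (on_state r)"
        using automaton_group_representative by blast
      then have "automaton_group (on_state r) \<cong> automaton_group A"
        using group.iso_sym[OF group_automaton_group] by blast
      with r have "rel `` {automaton_group A} = ?c r"
        unfolding rel_def by (auto intro: iso_trans)
      then show ?thesis using r by blast
    qed
    then have "iso_classes (range automaton_group) \<subseteq> ?c ` ?R"
      by (auto simp: iso_classes_def quotient_def rel_def)
    then show ?thesis
      using R by (meson card_image_le card_mono finite_imageI finite_subset le_trans)
  qed
  ultimately show ?thesis by blast
qed

end
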